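(* Let $(\Omega,(\mathcal{F}_k)_{k\ge 0},\mathbb{P})$ be a probability space equipped with a discrete time filtration such that $\mathcal{F}_0$ is the trivial sigma-algebra and such that for each $k\ge 1$ there is a random variable $U_k$, uniformly distributed on $[0,1]$, which is $\mathcal{F}_k$-measurable and independent of $\mathcal{F}_{k-1}$. Let $m\ge 1$ and let $(X_k)_{k\ge 0}$, $X_0=0$, be an $\mathbb{R}^m$-valued $L^2$ martingale with respect to $(\mathcal{F}_k)_{k\ge 0}$. Then there is a sequence $(Z^n)_{n\ge 1}$ of $\mathbb{R}^m$-valued martingales $Z^n=(Z^n_k)_{k\ge 0}$ with respect to $(\mathcal{F}_k)_{k\ge 0}$, with $Z^n_0=0$ for each $n$, such that $X_k=\sum_n Z^n_k$ for each $k$, and: (1) for each $n$ and each $k\ge 1$, $Z^n_k-Z^n_{k-1}$ is independent of $\mathcal{F}_{k-1}$; (2) for each $k\ge 1$ the sum $\sum_n Z^n_k$ converges in $L^2$; (3) for each $k\ge 1$, $\Vert X_k\Vert^2=\sum_n \Vert Z^n_k\Vert^2$. Moreover the martingales $Z^n$ have independent increments: for each $n$ the differences $(Z^n_k-Z^n_{k-1})_{k\ge 1}$ form an independent system.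
   Context: $|\cdot|$ is the Euclidean norm on $\mathbb{R}^m$, and $\Vert \cdot\Vert$ is the $L^2$ norm: $\Vert \xi\Vert^2=\mathbb{E}[|\xi|^2]$ for an $\mathbb{R}^m$-valued random variable $\xi$. An $\mathbb{R}^m$-valued $L^2$ martingale is an adapted process with $X_k\in L^2(\mathcal{F}_k)$ and $\mathbb{E}[X_k\mid\mathcal{F}_{k-1}]=X_{k-1}$ for all $k\ge 1$. *)

theory Defs
  imports "HOL-Probability.Probability"
begin

text \<open>The distribution's \<^locale>\<open>filtration\<close> does not relate its algebras to an ambient
  measure; here each of them is also required to be a sub-sigma-algebra of \<open>M\<close>.\<close>

definition filtered_prob_space :: "'a measure \<Rightarrow> (nat \<Rightarrow> 'a measure) \<Rightarrow> bool" where
  "filtered_prob_space M F \<longleftrightarrow>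
     prob_space M \<and> filtration (space M) F \<and> (\<forall>k. subalgebra M (F k))"

definition indep_of_algebra ::
    "'a measure \<Rightarrow> ('a \<Rightarrow> 'b::topological_space) \<Rightarrow> 'a measure \<Rightarrow> bool" where
  "indep_of_algebra M Y G \<longleftrightarrow>
     Y \<in> borel_measurable M \<and>
     prob_space.indep_set M (sets (vimage_algebra (space M) Y borel)) (sets G)"

definition square_integrable :: "'a measure \<Rightarrow> ('a \<Rightarrow> real ^ 'm) \<Rightarrow> bool" where
  "square_integrable M Y \<longleftrightarrow>
     Y \<in> borel_measurable M \<and> integrable M (\<lambda>\<omega>. (norm (Y \<omega>))\<^sup>2)"

definition L2_norm :: "'a measure \<Rightarrow> ('a \<Rightarrow> real ^ 'm) \<Rightarrow> real" where
  "L2_norm M Y = sqrt (\<integral>\<omega>. (norm (Y \<omega>))\<^sup>2 \<partial>M)"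

text \<open>The library has conditional expectations of real random variables only, so the
  martingale identity is imposed coordinatewise. As usual for conditional expectations, it is an
  almost sure identity.\<close>

definition L2_martingale ::
    "'a measure \<Rightarrow> (nat \<Rightarrow> 'a measure) \<Rightarrow> (nat \<Rightarrow> 'a \<Rightarrow> real ^ 'm) \<Rightarrow> bool" where
  "L2_martingale M F X \<longleftrightarrow>
     (\<forall>k. X k \<in> borel_measurable (F k)) \<and>
     (\<forall>k. square_integrable M (X k)) \<and>
     (\<forall>k\<ge>1. \<forall>i. AE \<omega> in M.
        real_cond_exp M (F (k - 1)) (\<lambda>\<omega>. X k \<omega> $ i) \<omega> = X (k - 1) \<omega> $ i)"

text \<open>The series \<open>Y 1 + Y 2 + \<dots>\<close> converges in \<open>L\<^sup>2\<close> with sum \<open>S\<close>; the index starts at 1.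
  Square integrability is required explicitly because the Bochner integral of a non-integrable
  function is 0.\<close>

definition L2_sums ::
    "'a measure \<Rightarrow> (nat \<Rightarrow> 'a \<Rightarrow> real ^ 'm) \<Rightarrow> ('a \<Rightarrow> real ^ 'm) \<Rightarrow> bool" where
  "L2_sums M Y S \<longleftrightarrow>
     (\<forall>n\<ge>1. square_integrable M (Y n)) \<and> square_integrable M S \<and>
     (\<lambda>N. L2_norm M (\<lambda>\<omega>. S \<omega> - (\<Sum>n=1..N. Y n \<omega>))) \<longlonglongrightarrow> 0"

end

theory Submission
  imports Defs
begin

text \<open>It suffices to expand a single increment \<open>D\<close> of the martingale: if \<open>G \<subseteq> H\<close>, \<open>D \<in> L\<^sup>2(H)\<close> and
  \<open>E[D | G] = 0\<close>, then \<open>D\<close> is an \<open>L\<^sup>2\<close> sum of centred variables \<open>Y n\<close> in \<open>L\<^sup>2(H)\<close>, independent of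
  \<open>G\<close>, with \<open>\<parallel>D\<parallel>\<^sup>2 = \<Sum> \<parallel>Y n\<parallel>\<^sup>2\<close>. The \<open>Y n\<close> are produced by the weak greedy algorithm (matching
  pursuit) over the normalised vectors \<open>(1\<^sub>E - P E) e\<^sub>i\<close>, where \<open>E \<in> H\<close> is independent of \<open>G\<close>;
  each step subtracts an orthogonal projection onto a line, which gives the identity for the norms
  once the remainders tend to 0. They do so because a function orthogonal to \<open>L\<^sup>2(G)\<close> that is almost
  orthogonal to all events \<open>E\<close> is almost orthogonal to every event \<open>B \<in> H\<close>. Indeed the
  conditional quantiles given \<open>G\<close> of a variable that is smaller on \<open>B\<close> than off \<open>B\<close>, with ties
  broken by the uniform variable, cut the space into \<open>N\<close> events \<open>C i\<close> of probability \<open>1/N\<close>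
  independent of \<open>G\<close>, and \<open>B\<close> is, up to probability \<open>1/N\<close>, a union of sets \<open>C i \<inter> A i\<close> with
  \<open>A i \<in> G\<close>. For \<open>A \<in> G\<close> the event \<open>(C i \<inter> A) \<union> (C l - A)\<close> is again independent of \<open>G\<close>, so
  \<open>C i \<inter> A\<close> and \<open>C l \<inter> A\<close> are almost indistinguishable to the remainder, while the \<open>C l \<inter> A\<close>
  add up to \<open>A\<close>, to which it is orthogonal.\<close>

subsection \<open>Square integrable functions and the weak greedy algorithm\<close>

lemma square_integrable_borel: "square_integrable M f \<Longrightarrow> f \<in> borel_measurable M"
  by (simp add: square_integrable_def)

lemma square_integrable_norm2: "square_integrable M f \<Longrightarrow> integrable M (\<lambda>x. (norm (f x))\<^sup>2)"
  by (simp add: square_integrable_def)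

lemma borel_measurable_nth_compose:
  fixes f :: "'a \<Rightarrow> real ^ 'm"
  shows "f \<in> borel_measurable M \<Longrightarrow> (\<lambda>x. f x $ i) \<in> borel_measurable M"
  by (rule borel_measurable_continuous_on[where f = "\<lambda>v. v $ i"]) (auto intro: continuous_intros)

lemma square_integrable_inner:
  fixes f g :: "'a \<Rightarrow> real ^ 'm"
  assumes "square_integrable M f" "square_integrable M g"
  shows "integrable M (\<lambda>x. f x \<bullet> g x)"
proof (rule Bochner_Integration.integrable_bound)
  show "integrable M (\<lambda>x. (norm (f x))\<^sup>2 + (norm (g x))\<^sup>2)"
    using assms by (auto simp: square_integrable_def)
  show "(\<lambda>x. f x \<bullet> g x) \<in> borel_measurable M"
    using assms by (auto simp: square_integrable_def)
  show "AE x in M. norm (f x \<bullet> g x) \<le> norm ((norm (f x))\<^sup>2 + (norm (g x))\<^sup>2)"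
  proof (rule AE_I2)
    fix x
    have "\<bar>f x \<bullet> g x\<bar> \<le> norm (f x) * norm (g x)" by (rule Cauchy_Schwarz_ineq2)
    also have "\<dots> \<le> (norm (f x))\<^sup>2 + (norm (g x))\<^sup>2"
      using sum_squares_bound[of "norm (f x)" "norm (g x)"]
        mult_nonneg_nonneg[OF norm_ge_zero[of "f x"] norm_ge_zero[of "g x"]] by linarith
    finally show "norm (f x \<bullet> g x) \<le> norm ((norm (f x))\<^sup>2 + (norm (g x))\<^sup>2)" by simp
  qed
qed

lemma square_integrable_add:
  fixes f g :: "'a \<Rightarrow> real ^ 'm"
  assumes "square_integrable M f" "square_integrable M g"
  shows "square_integrable M (\<lambda>x. f x + g x)"
proof -
  have "(\<lambda>x. (norm (f x + g x))\<^sup>2) = (\<lambda>x. (norm (f x))\<^sup>2 + 2 * (f x \<bullet> g x) + (norm (g x))\<^sup>2)"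
    by (auto simp: power2_norm_eq_inner inner_add_left inner_add_right inner_commute)
  then show ?thesis
    using assms square_integrable_inner[OF assms] by (auto simp: square_integrable_def)
qed

lemma square_integrable_scaleR:
  "square_integrable M f \<Longrightarrow> square_integrable M (\<lambda>x. c *\<^sub>R f x)"
  by (auto simp: square_integrable_def power_mult_distrib)

lemma square_integrable_diff:
  fixes f g :: "'a \<Rightarrow> real ^ 'm"
  assumes "square_integrable M f" "square_integrable M g"
  shows "square_integrable M (\<lambda>x. f x - g x)"
  using square_integrable_add[OF assms(1) square_integrable_scaleR[OF assms(2), of "-1"]] by simp

lemma square_integrable_zero [simp]: "square_integrable M (\<lambda>x. 0)"
  by (simp add: square_integrable_def)

lemma square_integrable_sum:
  fixes f :: "'i \<Rightarrow> 'a \<Rightarrow> real ^ 'm"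
  shows "(\<And>j. j \<in> J \<Longrightarrow> square_integrable M (f j)) \<Longrightarrow> square_integrable M (\<lambda>x. \<Sum>j\<in>J. f j x)"
  by (induction J rule: infinite_finite_induct) (auto intro: square_integrable_add)

lemma square_integrable_nth:
  assumes "square_integrable M f"
  shows "integrable M (\<lambda>x. (f x $ i)\<^sup>2)"
proof (rule Bochner_Integration.integrable_bound[OF square_integrable_norm2[OF assms]])
  show "(\<lambda>x. (f x $ i)\<^sup>2) \<in> borel_measurable M"
    using borel_measurable_nth_compose[OF square_integrable_borel[OF assms]] by simp
  show "AE x in M. norm ((f x $ i)\<^sup>2) \<le> norm ((norm (f x))\<^sup>2)"
    by (rule AE_I2) (use component_le_norm_cart in \<open>auto simp: abs_le_square_iff[symmetric]\<close>)
qed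

lemma (in finite_measure) square_integrable_integrable_nth:
  assumes "square_integrable M f"
  shows "integrable M (\<lambda>x. f x $ i)"
  by (rule square_integrable_imp_integrable[OF _ square_integrable_nth[OF assms]])
     (rule borel_measurable_nth_compose[OF square_integrable_borel[OF assms]])

lemma integral_norm2_add:
  fixes f g :: "'a \<Rightarrow> real ^ 'm"
  assumes "square_integrable M f" "square_integrable M g"
  shows "(\<integral>x. (norm (f x + g x))\<^sup>2 \<partial>M) =
    (\<integral>x. (norm (f x))\<^sup>2 \<partial>M) + 2 * (\<integral>x. f x \<bullet> g x \<partial>M) + (\<integral>x. (norm (g x))\<^sup>2 \<partial>M)"
proof -
  have "(\<lambda>x. (norm (f x + g x))\<^sup>2) = (\<lambda>x. (norm (f x))\<^sup>2 + 2 * (f x \<bullet> g x) + (norm (g x))\<^sup>2)"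
    by (auto simp: power2_norm_eq_inner inner_add_left inner_add_right inner_commute)
  then show ?thesis
    using assms square_integrable_inner[OF assms] by (auto simp: square_integrable_def)
qed

lemma L2_norm_power2: "(L2_norm M f)\<^sup>2 = (\<integral>x. (norm (f x))\<^sup>2 \<partial>M)"
  by (simp add: L2_norm_def)

lemma L2_norm_nonneg [simp]: "0 \<le> L2_norm M f"
  by (simp add: L2_norm_def)

text \<open>The discriminant argument: \<open>\<parallel>f + t g\<parallel>\<^sup>2\<close> is a
  quadratic polynomial in \<open>t\<close> without negative values.\<close>

lemma L2_Cauchy_Schwarz:
  fixes f g :: "'a \<Rightarrow> real ^ 'm"
  assumes f: "square_integrable M f" and g: "square_integrable M g"
  shows "\<bar>\<integral>x. f x \<bullet> g x \<partial>M\<bar> \<le> L2_norm M f * L2_norm M g"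
proof -
  define a b c where "a = (\<integral>x. (norm (g x))\<^sup>2 \<partial>M)" and "b = (\<integral>x. f x \<bullet> g x \<partial>M)"
    and "c = (\<integral>x. (norm (f x))\<^sup>2 \<partial>M)"
  have q: "0 \<le> c + 2 * (t * b) + t\<^sup>2 * a" for t
  proof -
    have "0 \<le> (\<integral>x. (norm (f x + t *\<^sub>R g x))\<^sup>2 \<partial>M)" by simp
    also have "\<dots> = c + 2 * (t * b) + t\<^sup>2 * a"
      using integral_norm2_add[OF f square_integrable_scaleR[OF g, of t]]
      by (simp add: a_def b_def c_def power_mult_distrib)
    finally show ?thesis .
  qed
  have "a \<ge> 0" "c \<ge> 0" by (auto simp: a_def c_def)
  have "b\<^sup>2 \<le> c * a"
  proof (cases "a = 0")
    case True
    have "b = 0"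
    proof (rule ccontr)
      assume "b \<noteq> 0"
      \<comment> \<open>With \<open>a = 0\<close> the quadratic is affine in \<open>t\<close>, and
        at this \<open>t\<close> it would take the value -1.\<close>
      then have "- (c + 1) / (2 * b) * b = - (c + 1) / 2" by simp
      with q[of "- (c + 1) / (2 * b)"] True \<open>c \<ge> 0\<close> show False by simp
    qed
    with True show ?thesis by simp
  next
    case False
    with \<open>a \<ge> 0\<close> have "a > 0" by simp
    with q[of "- b / a"] show ?thesis
      by (simp add: field_simps power2_eq_square)
  qed
  then have "\<bar>b\<bar> \<le> sqrt (c * a)"
    using real_le_rsqrt[of "\<bar>b\<bar>"] by simp
  then show ?thesis by (simp add: real_sqrt_mult L2_norm_def a_def b_def c_def)
qed

section \<open>Convergence of the weak greedy algorithm\<close>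

text \<open>Otherwise \<open>(c m)\<^sup>2\<close> would be bounded below by a multiple of \<open>1/m\<close>, since by Cauchy--Schwarz the
  partial sum is at most of order \<open>sqrt m\<close>.\<close>

lemma small_partial_sum_product:
  fixes c :: "nat \<Rightarrow> real"
  assumes "summable (\<lambda>n. (c n)\<^sup>2)" and "\<epsilon> > 0"
  shows "\<exists>m\<ge>n0. \<bar>c m\<bar> * (\<Sum>j<m. \<bar>c j\<bar>) < \<epsilon>"
proof (rule ccontr)
  assume "\<not> ?thesis"
  then have large: "\<epsilon> \<le> \<bar>c m\<bar> * (\<Sum>j<m. \<bar>c j\<bar>)" if "m \<ge> n0" for m
    using that by (auto simp: not_less)
  define K where "K = (\<Sum>n. (c n)\<^sup>2)"
  have "K \<ge> 0" unfolding K_def by (rule suminf_nonneg[OF assms(1)]) simp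
  have S2: "(\<Sum>j<m. \<bar>c j\<bar>)\<^sup>2 \<le> real m * K" for m
  proof -
    have "(\<Sum>j<m. \<bar>c j\<bar>)\<^sup>2 \<le> real (card {..<m}) * (\<Sum>j<m. \<bar>c j\<bar>\<^sup>2)"
      using Cauchy_Schwarz_ineq_sum[of "\<lambda>_. 1" "\<lambda>j. \<bar>c j\<bar>" "{..<m}"] by simp
    also have "\<dots> \<le> real m * K"
      using sum_le_suminf[OF assms(1), of "{..<m}"] by (simp add: K_def mult_left_mono)
    finally show ?thesis .
  qed
  \<comment> \<open>\<open>K + 1\<close> keeps the divisor positive when all coefficients vanish;
    starting at \<open>Suc n0\<close> keeps \<open>m\<close> positive.\<close>
  have bound: "\<epsilon>\<^sup>2 / (K + 1) * inverse (real m) \<le> (c m)\<^sup>2" if "m \<ge> Suc n0" for m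
  proof -
    have "\<epsilon>\<^sup>2 \<le> (\<bar>c m\<bar> * (\<Sum>j<m. \<bar>c j\<bar>))\<^sup>2"
      using large[of m] that assms(2) by (intro power_mono) auto
    also have "\<dots> \<le> (c m)\<^sup>2 * (real m * K)"
      using S2[of m] by (simp add: power_mult_distrib mult_left_mono)
    also have "\<dots> \<le> (c m)\<^sup>2 * (real m * (K + 1))"
      by (intro mult_left_mono) auto
    finally have "\<epsilon>\<^sup>2 \<le> (c m)\<^sup>2 * ((K + 1) * real m)" by (simp add: mult.commute)
    moreover have "(K + 1) * real m > 0" using that \<open>K \<ge> 0\<close> by simp
    ultimately have "\<epsilon>\<^sup>2 / ((K + 1) * real m) \<le> (c m)\<^sup>2" by (simp only: pos_divide_le_eq)
    then show ?thesis by (simp add: divide_inverse mult.assoc)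
  qed
  have "summable (\<lambda>m. \<epsilon>\<^sup>2 / (K + 1) * inverse (real m))"
    by (rule summable_comparison_test'[OF assms(1), of "Suc n0"])
       (use bound \<open>K \<ge> 0\<close> in auto)
  then have "summable (\<lambda>m. inverse (real m))"
    using assms(2) \<open>K \<ge> 0\<close> by (subst (asm) summable_cmult_iff) auto
  then show False using not_summable_harmonic[where 'a = real] by simp
qed

text \<open>Jones' convergence argument for greedy algorithms. The hypothesis \<open>weak\<close> replaces both the
  totality of the dictionary and the completeness of \<open>L\<^sup>2\<close>: remainders that are asymptotically
  orthogonal to the dictionary are asymptotically orthogonal to \<open>D\<close> itself. The zero function is
  allowed in the dictionary to accommodate normalisation of null vectors by \<open>x/0 = 0\<close>.\<close>

lemma weak_greedy_expansion:
  fixes D :: "'a \<Rightarrow> real ^ 'm" and \<D> :: "('a \<Rightarrow> real ^ 'm) set"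
  assumes D: "square_integrable M D"
    and \<D>: "\<And>g. g \<in> \<D> \<Longrightarrow> square_integrable M g"
    and unit: "\<And>g. g \<in> \<D> \<Longrightarrow> (\<integral>x. (norm (g x))\<^sup>2 \<partial>M) = 1 \<or> g = (\<lambda>_. 0)"
    and ne: "\<D> \<noteq> {}"
    and weak: "\<And>h c \<delta>. (\<And>j. h j \<in> \<D>) \<Longrightarrow> \<delta> \<longlonglongrightarrow> 0 \<Longrightarrow>
      (\<And>n. L2_norm M (\<lambda>x. D x - (\<Sum>j<n. c j *\<^sub>R h j x)) \<le> L2_norm M D) \<Longrightarrow>
      (\<And>n g. g \<in> \<D> \<Longrightarrow> \<bar>\<integral>x. (D x - (\<Sum>j<n. c j *\<^sub>R h j x)) \<bullet> g x \<partial>M\<bar> \<le> \<delta> n) \<Longrightarrow>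
      (\<lambda>n. \<integral>x. (D x - (\<Sum>j<n. c j *\<^sub>R h j x)) \<bullet> D x \<partial>M) \<longlonglongrightarrow> 0"
  shows "\<exists>h c. (\<forall>j. h j \<in> \<D>) \<and>
    (\<lambda>n. L2_norm M (\<lambda>x. D x - (\<Sum>j<n. c j *\<^sub>R h j x))) \<longlonglongrightarrow> 0 \<and>
    (\<lambda>j. (L2_norm M (\<lambda>x. c j *\<^sub>R h j x))\<^sup>2) sums (L2_norm M D)\<^sup>2"
proof -
  \<comment> \<open>The supremum over the dictionary need not be attained; the factor 2 admits a
    near-maximiser. If the supremum is not positive, every element qualifies.\<close>
  have "\<exists>g\<in>\<D>. \<forall>g'\<in>\<D>. \<bar>\<integral>x. r x \<bullet> g' x \<partial>M\<bar> \<le> 2 * \<bar>\<integral>x. r x \<bullet> g x \<partial>M\<bar>"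
    if r: "square_integrable M r" for r :: "'a \<Rightarrow> real ^ 'm"
  proof -
    define S where "S = (\<lambda>g. \<bar>\<integral>x. r x \<bullet> g x \<partial>M\<bar>) ` \<D>"
    have bdd: "bdd_above S"
    proof (rule bdd_aboveI)
      fix y assume "y \<in> S"
      then obtain g where g: "g \<in> \<D>" "y = \<bar>\<integral>x. r x \<bullet> g x \<partial>M\<bar>" by (auto simp: S_def)
      have "L2_norm M g \<le> 1" using unit[OF g(1)] by (auto simp: L2_norm_def)
      then show "y \<le> L2_norm M r * 1"
        using L2_Cauchy_Schwarz[OF r \<D>[OF g(1)]] mult_left_mono[of "L2_norm M g" 1 "L2_norm M r"] g
        by simp
    qed
    show ?thesis
    proof (cases "Sup S > 0")
      case True
      then have "Sup S / 2 < Sup S" by simp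
      then obtain y where "y \<in> S" "Sup S / 2 < y"
        using less_cSup_iff[OF _ bdd, of "Sup S / 2"] ne unfolding S_def by blast
      then obtain g where g: "g \<in> \<D>" "Sup S / 2 < \<bar>\<integral>x. r x \<bullet> g x \<partial>M\<bar>" by (auto simp: S_def)
      show ?thesis
      proof (intro bexI[of _ g] ballI)
        fix g' assume "g' \<in> \<D>"
        then have "\<bar>\<integral>x. r x \<bullet> g' x \<partial>M\<bar> \<le> Sup S" by (intro cSup_upper[OF _ bdd]) (auto simp: S_def)
        with g show "\<bar>\<integral>x. r x \<bullet> g' x \<partial>M\<bar> \<le> 2 * \<bar>\<integral>x. r x \<bullet> g x \<partial>M\<bar>" by linarith
      qed (use g in simp)
    next
      case False
      have "\<bar>\<integral>x. r x \<bullet> g' x \<partial>M\<bar> \<le> 0" if "g' \<in> \<D>" for g'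
      proof -
        have "\<bar>\<integral>x. r x \<bullet> g' x \<partial>M\<bar> \<le> Sup S"
          using that by (intro cSup_upper[OF _ bdd]) (auto simp: S_def)
        with False show ?thesis by linarith
      qed
      moreover obtain g where "g \<in> \<D>" using ne by auto
      ultimately show ?thesis by (force intro!: bexI[of _ g])
    qed
  qed
  then obtain sel where sel: "\<And>r :: 'a \<Rightarrow> real ^ 'm. square_integrable M r \<Longrightarrow> sel r \<in> \<D>"
    "\<And>(r :: 'a \<Rightarrow> real ^ 'm) g'. square_integrable M r \<Longrightarrow> g' \<in> \<D> \<Longrightarrow>
        \<bar>\<integral>x. r x \<bullet> g' x \<partial>M\<bar> \<le> 2 * \<bar>\<integral>x. r x \<bullet> sel r x \<partial>M\<bar>"
    by metis
  \<comment> \<open>Matching pursuit: each remainder loses its orthogonal projection onto the line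
    of the selected unit vector, so the coefficient is an inner product with the current
    remainder.\<close>
  define R where "R = rec_nat D (\<lambda>_ r x. r x - (\<integral>y. r y \<bullet> sel r y \<partial>M) *\<^sub>R sel r x)"
  define h where "h n = sel (R n)" for n
  define c where "c n = (\<integral>y. R n y \<bullet> h n y \<partial>M)" for n
  have R0: "R 0 = D" and RSuc: "R (Suc n) = (\<lambda>x. R n x - c n *\<^sub>R h n x)" for n
    by (simp_all add: R_def h_def c_def)
  have R: "square_integrable M (R n)" for n
  proof (induction n)
    case (Suc n)
    then show ?case
      unfolding RSuc h_def
      by (intro square_integrable_diff square_integrable_scaleR \<D>[OF sel(1)])
  qed (simp add: R0 D)
  have h: "h n \<in> \<D>" for n unfolding h_def by (rule sel(1)[OF R])
  note hs = \<D>[OF h]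
  have R_eq: "R n = (\<lambda>x. D x - (\<Sum>j<n. c j *\<^sub>R h j x))" for n
    by (induction n) (auto simp: R0 RSuc algebra_simps)
  have greedy: "\<bar>\<integral>x. R n x \<bullet> g x \<partial>M\<bar> \<le> 2 * \<bar>c n\<bar>" if "g \<in> \<D>" for n g
    unfolding c_def h_def by (rule sel(2)[OF R that])
  \<comment> \<open>If \<open>h n\<close> is the zero function, then \<open>c n\<close> is 0 as
    well, so the identity also covers that case.\<close>
  have term_norm: "(L2_norm M (\<lambda>x. c n *\<^sub>R h n x))\<^sup>2 = (c n)\<^sup>2" for n
    using unit[OF h[of n]] by (auto simp: L2_norm_power2 power_mult_distrib c_def)
  have step: "(L2_norm M (R (Suc n)))\<^sup>2 = (L2_norm M (R n))\<^sup>2 - (c n)\<^sup>2" for n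
  proof -
    have "(L2_norm M (R (Suc n)))\<^sup>2 = (\<integral>x. (norm (R n x + (- c n) *\<^sub>R h n x))\<^sup>2 \<partial>M)"
      by (simp add: L2_norm_power2 RSuc)
    also have "\<dots> = (L2_norm M (R n))\<^sup>2 - 2 * (c n * c n) + (L2_norm M (\<lambda>x. c n *\<^sub>R h n x))\<^sup>2"
      unfolding integral_norm2_add[OF R square_integrable_scaleR[OF hs]]
      by (simp add: L2_norm_power2 c_def)
    finally show ?thesis by (simp only: term_norm) (simp add: power2_eq_square)
  qed
  have energy: "(\<Sum>j<n. (c j)\<^sup>2) = (L2_norm M D)\<^sup>2 - (L2_norm M (R n))\<^sup>2" for n
    by (induction n) (auto simp: R0 step)
  have "summable (\<lambda>n. (c n)\<^sup>2)"
    by (rule summableI_nonneg_bounded[where x = "(L2_norm M D)\<^sup>2"]) (auto simp: energy)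
  note sumc = this
  then have "(\<lambda>n. (c n)\<^sup>2) \<longlonglongrightarrow> 0" by (rule summable_LIMSEQ_zero)
  then have "(\<lambda>n. sqrt ((c n)\<^sup>2)) \<longlonglongrightarrow> sqrt 0" by (intro tendsto_real_sqrt)
  then have c0: "(\<lambda>n. 2 * \<bar>c n\<bar>) \<longlonglongrightarrow> 0" by (auto intro: tendsto_mult_right_zero)
  have mono: "L2_norm M (R n) \<le> L2_norm M (R m)" if "m \<le> n" for m n
  proof (rule lift_Suc_antimono_le[OF _ that])
    fix n have "(L2_norm M (R (Suc n)))\<^sup>2 \<le> (L2_norm M (R n))\<^sup>2" by (simp add: step)
    then show "L2_norm M (R (Suc n)) \<le> L2_norm M (R n)" by (rule power2_le_imp_le) simp
  qed
  \<comment> \<open>The greedy choice supplies the bound required by \<open>weak\<close>, with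
    \<open>2 * \<bar>c n\<bar>\<close> as \<open>\<delta> n\<close>; this tends to 0 because the
    squares are summable.\<close>
  have RD: "(\<lambda>n. \<integral>x. R n x \<bullet> D x \<partial>M) \<longlonglongrightarrow> 0"
    unfolding R_eq
  proof (rule weak[where h = h and c = c, OF h c0])
    show "L2_norm M (\<lambda>x. D x - (\<Sum>j<n. c j *\<^sub>R h j x)) \<le> L2_norm M D" for n
      using mono[of 0 n] by (simp add: R_eq)
  qed (use greedy in \<open>simp add: R_eq\<close>)
  \<comment> \<open>One factor \<open>R m\<close> is expanded into \<open>D\<close> and the earlier
    terms. The choice made at step \<open>m\<close> bounds the inner products of \<open>R m\<close>
    with all earlier \<open>h j\<close> by the same number
    \<open>2 * \<bar>c m\<bar>\<close>.\<close>
  have R2: "(L2_norm M (R m))\<^sup>2 \<le> (\<integral>x. R m x \<bullet> D x \<partial>M) + 2 * (\<bar>c m\<bar> * (\<Sum>j<m. \<bar>c j\<bar>))" for m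
  proof -
    have Rh: "\<bar>\<integral>x. R m x \<bullet> h j x \<partial>M\<bar> \<le> 2 * \<bar>c m\<bar>" for j by (rule greedy[OF h])
    have "(L2_norm M (R m))\<^sup>2 = (\<integral>x. R m x \<bullet> (D x - (\<Sum>j<m. c j *\<^sub>R h j x)) \<partial>M)"
      unfolding L2_norm_power2 power2_norm_eq_inner by (simp add: R_eq)
    also have "\<dots> = (\<integral>x. R m x \<bullet> D x - (\<Sum>j<m. c j * (R m x \<bullet> h j x)) \<partial>M)"
      by (simp add: inner_diff_right inner_sum_right)
    also have "\<dots> = (\<integral>x. R m x \<bullet> D x \<partial>M) - (\<Sum>j<m. c j * (\<integral>x. R m x \<bullet> h j x \<partial>M))"
      using square_integrable_inner[OF R D] square_integrable_inner[OF R hs]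
      by (subst Bochner_Integration.integral_diff) auto
    also have "\<dots> \<le> (\<integral>x. R m x \<bullet> D x \<partial>M) + (\<Sum>j<m. \<bar>c j\<bar> * (2 * \<bar>c m\<bar>))"
    proof -
      have "- (\<Sum>j<m. c j * (\<integral>x. R m x \<bullet> h j x \<partial>M)) \<le> (\<Sum>j<m. \<bar>c j * (\<integral>x. R m x \<bullet> h j x \<partial>M)\<bar>)"
        using sum_abs[of "\<lambda>j. c j * (\<integral>x. R m x \<bullet> h j x \<partial>M)" "{..<m}"] by linarith
      also have "\<dots> \<le> (\<Sum>j<m. \<bar>c j\<bar> * (2 * \<bar>c m\<bar>))"
        by (intro sum_mono) (auto simp: abs_mult intro!: mult_left_mono Rh)
      finally show ?thesis by simp
    qed
    finally show ?thesis by (simp add: sum_distrib_left sum_distrib_right mult_ac)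
  qed
  \<comment> \<open>The product of \<open>\<bar>c m\<bar>\<close> with the partial sum is only known
    to be small for suitable, arbitrarily large \<open>m\<close>. Since the norms of the remainders
    decrease, one such \<open>m\<close> settles all later indices.\<close>
  have R_lim: "(\<lambda>n. L2_norm M (R n)) \<longlonglongrightarrow> 0"
  proof (rule LIMSEQ_I)
    fix r :: real assume "r > 0"
    then have e: "r\<^sup>2 / 4 > 0" by simp
    obtain n0 where n0: "\<And>n. n \<ge> n0 \<Longrightarrow> \<bar>\<integral>x. R n x \<bullet> D x \<partial>M\<bar> < r\<^sup>2 / 4"
      using LIMSEQ_D[OF RD e] by auto
    obtain m where m: "m \<ge> n0" "\<bar>c m\<bar> * (\<Sum>j<m. \<bar>c j\<bar>) < r\<^sup>2 / 4"
      using small_partial_sum_product[OF sumc e] by blast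
    have "(L2_norm M (R m))\<^sup>2 < r\<^sup>2" using R2[of m] n0[OF m(1)] m(2) e by linarith
    then have "L2_norm M (R m) < r" using \<open>r > 0\<close> by (auto intro: power_less_imp_less_base)
    then show "\<exists>no. \<forall>n\<ge>no. norm (L2_norm M (R n) - 0) < r"
      using mono[of m] by (intro exI[of _ m]) (auto intro: le_less_trans)
  qed
  have "(\<lambda>n. (L2_norm M D)\<^sup>2 - (L2_norm M (R n))\<^sup>2) \<longlonglongrightarrow> (L2_norm M D)\<^sup>2 - 0\<^sup>2"
    by (intro tendsto_intros R_lim)
  then have "(\<lambda>j. (L2_norm M (\<lambda>x. c j *\<^sub>R h j x))\<^sup>2) sums (L2_norm M D)\<^sup>2"
    unfolding sums_def term_norm energy by simp
  with R_lim h show ?thesis unfolding R_eq by blast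
qed

subsection \<open>Conditional quantiles\<close>

locale prob_subalgebra = prob_space M for M :: "'a measure" +
  fixes G :: "'a measure"
  assumes sub: "subalgebra M G"

sublocale prob_subalgebra \<subseteq> finite_measure_subalgebra M G
  by unfold_locales (rule sub)

context prob_subalgebra
begin

lemma space_G: "space G = space M"
  using sub by (simp add: subalgebra_def)

lemma sets_G: "A \<in> sets G \<Longrightarrow> A \<in> sets M"
  using sub by (auto simp: subalgebra_def)

lemma measurable_G: "f \<in> borel_measurable G \<Longrightarrow> f \<in> borel_measurable M"
  by (rule measurable_from_subalg[OF sub])

lemma integrable_indicator_event: "A \<in> sets M \<Longrightarrow> integrable M (indicator A :: 'a \<Rightarrow> real)"
  by (intro integrable_real_indicator) (simp_all add: emeasure_eq_measure)

lemma integrable_indicator_mult: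
  assumes "E \<in> sets M" "A \<in> sets G"
  shows "integrable M (\<lambda>x. indicator A x * indicator E x :: real)"
proof (rule Bochner_Integration.integrable_bound[where f = "\<lambda>_. 1 :: real"])
  show "(\<lambda>x. indicator A x * indicator E x :: real) \<in> borel_measurable M"
    using assms(1) sets_G[OF assms(2)] by measurable
qed (auto simp: indicator_def)

lemma prob_Int_cond_exp:
  assumes "E \<in> sets M" "A \<in> sets G"
  shows "prob (E \<inter> A) = (\<integral>x. indicator A x * real_cond_exp M G (indicator E) x \<partial>M)"
proof -
  have "(\<integral>x. indicator A x * real_cond_exp M G (indicator E) x \<partial>M)
      = (\<integral>x. indicator A x * indicator E x \<partial>M)"
    using assms by (intro real_cond_exp_intg(2) integrable_indicator_mult) auto
  also have "\<dots> = (\<integral>x. indicator (E \<inter> A) x \<partial>M)"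
    by (intro Bochner_Integration.integral_cong) (auto simp: indicator_def)
  finally show ?thesis using assms(1) sets_G[OF assms(2)] by simp
qed

text \<open>Integrating the conditional probability over \<open>A\<close>. Applied to level sets
  \<open>A\<close> of a discretised random threshold, this and its counterpart for lower bounds
  reduce a random threshold to deterministic ones.\<close>

lemma prob_Int_cond_le:
  assumes E: "E \<in> sets M" and A: "A \<in> sets G"
    and le: "AE x in M. x \<in> A \<longrightarrow> real_cond_exp M G (indicator E) x \<le> q"
  shows "prob (E \<inter> A) \<le> q * prob A"
proof -
  have "prob (E \<inter> A) \<le> (\<integral>x. q * indicator A x \<partial>M)"
    unfolding prob_Int_cond_exp[OF E A]
  proof (rule integral_mono_AE)
    show "integrable M (\<lambda>x. indicator A x * real_cond_exp M G (indicator E) x)"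
      using E A by (intro real_cond_exp_intg(1) integrable_indicator_mult) auto
    show "integrable M (\<lambda>x. q * indicator A x)"
      by (intro integrable_mult_right integrable_indicator_event sets_G A)
  qed (use le in \<open>auto simp: indicator_def\<close>)
  then show ?thesis using sets_G[OF A] by simp
qed

lemma prob_Int_cond_ge:
  assumes E: "E \<in> sets M" and A: "A \<in> sets G"
    and ge: "AE x in M. x \<in> A \<longrightarrow> q \<le> real_cond_exp M G (indicator E) x"
  shows "q * prob A \<le> prob (E \<inter> A)"
proof -
  have "(\<integral>x. q * indicator A x \<partial>M) \<le> prob (E \<inter> A)"
    unfolding prob_Int_cond_exp[OF E A]
  proof (rule integral_mono_AE)
    show "integrable M (\<lambda>x. indicator A x * real_cond_exp M G (indicator E) x)"
      using E A by (intro real_cond_exp_intg(1) integrable_indicator_mult) auto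
    show "integrable M (\<lambda>x. q * indicator A x)"
      by (intro integrable_mult_right integrable_indicator_event sets_G A)
  qed (use ge in \<open>auto simp: indicator_def\<close>)
  then show ?thesis using sets_G[OF A] by simp
qed

lemma prob_finite_partition:
  fixes k :: "'a \<Rightarrow> int"
  assumes k: "k \<in> measurable M (count_space UNIV)" and J: "finite J" "\<And>x. x \<in> space M \<Longrightarrow> k x \<in> J"
    and E: "E \<in> sets M"
  shows "prob E = (\<Sum>j\<in>J. prob (E \<inter> {x \<in> space M. k x = j}))"
proof -
  have [measurable]: "k \<in> measurable M (count_space UNIV)" by (rule k)
  have "prob E = prob (\<Union>j\<in>J. E \<inter> {x \<in> space M. k x = j})"
    using J sets.sets_into_space[OF E] by (intro arg_cong[where f = prob]) auto
  also have "\<dots> = (\<Sum>j\<in>J. prob (E \<inter> {x \<in> space M. k x = j}))"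
    using J E by (intro finite_measure_finite_Union) (auto simp: disjoint_family_on_def)
  finally show ?thesis .
qed

text \<open>Dominated convergence of the indicators. The discretised events to which this is applied
  need not be monotone in \<open>n\<close>, so it takes the place of continuity of the measure along
  monotone sequences.\<close>

lemma tendsto_prob_eventually_eq:
  assumes E: "\<And>n. E n \<in> sets M" "E' \<in> sets M"
    and ev: "\<And>x. x \<in> space M \<Longrightarrow> eventually (\<lambda>n. x \<in> E n \<longleftrightarrow> x \<in> E') sequentially"
  shows "(\<lambda>n. prob (E n)) \<longlonglongrightarrow> prob E'"
proof -
  have "(\<lambda>n. \<integral>x. indicator (E n) x \<partial>M) \<longlonglongrightarrow> (\<integral>x. (indicator E' x :: real) \<partial>M)"
  proof (rule integral_dominated_convergence[where w = "\<lambda>_. 1"])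
    show "AE x in M. (\<lambda>n. indicator (E n) x :: real) \<longlonglongrightarrow> indicator E' x"
    proof (rule AE_I2, rule tendsto_eventually)
      fix x assume "x \<in> space M"
      from ev[OF this] show "\<forall>\<^sub>F n in sequentially. indicator (E n) x = (indicator E' x :: real)"
        by eventually_elim (simp add: indicator_def)
    qed
  qed (use E in \<open>auto simp: indicator_def\<close>)
  then show ?thesis using E by simp
qed

text \<open>\<open>t q\<close> is the generalised inverse at \<open>q\<close> of the conditional
  distribution function of \<open>W\<close> given \<open>G\<close>. Restricting the levels to
  rationals makes do with countably many conditional probabilities, without a regular conditional
  distribution. Absence of atoms at \<open>G\<close>-measurable points makes the quantile
  exact.\<close>

lemma conditional_quantile:
  fixes W :: "'a \<Rightarrow> real"
  assumes W[measurable]: "W \<in> borel_measurable M"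
    and bounds: "AE x in M. 0 \<le> W x \<and> W x \<le> b" and b: "b \<in> \<rat>" "0 \<le> b"
    and atomless: "\<And>t. t \<in> borel_measurable G \<Longrightarrow> prob {x \<in> space M. W x = t x} = 0"
  obtains t :: "real \<Rightarrow> 'a \<Rightarrow> real"
  where "\<And>q. t q \<in> borel_measurable G" "\<And>q q' x. q \<le> q' \<Longrightarrow> t q x \<le> t q' x"
    "\<And>q A. 0 \<le> q \<Longrightarrow> q \<le> 1 \<Longrightarrow> A \<in> sets G \<Longrightarrow>
       prob ({x \<in> space M. W x \<le> t q x} \<inter> A) = q * prob A"
proof -
  define L where "L r = {x \<in> space M. W x \<le> r}" for r
  have L[measurable]: "L r \<in> sets M" for r by (simp add: L_def)
  define Q where "Q r = real_cond_exp M G (indicator (L r))" for r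
  have Q[measurable]: "Q r \<in> borel_measurable G" for r by (simp add: Q_def)
  note int_ind = integrable_indicator_event[OF L]
  \<comment> \<open>Monotonicity and the boundary values hold almost surely for each rational level,
    hence simultaneously outside one null set.\<close>
  have "AE x in M. \<forall>r\<in>\<rat>. \<forall>r'\<in>\<rat>. r \<le> r' \<longrightarrow> Q r x \<le> Q r' x"
  proof (intro AE_ball_countable[THEN iffD2] ballI countable_rat)
    fix r r' :: real
    show "AE x in M. r \<le> r' \<longrightarrow> Q r x \<le> Q r' x"
    proof (cases "r \<le> r'")
      case True
      then have "AE x in M. indicator (L r) x \<le> (indicator (L r') x :: real)"
        by (intro AE_I2) (auto simp: L_def indicator_def)
      from real_cond_exp_mono[OF this int_ind int_ind] show ?thesis by (auto simp: Q_def)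
    qed auto
  qed
  moreover have "AE x in M. \<forall>r\<in>\<rat>. r < 0 \<longrightarrow> Q r x = 0"
  proof (intro AE_ball_countable[THEN iffD2] ballI countable_rat)
    fix r :: real
    show "AE x in M. r < 0 \<longrightarrow> Q r x = 0"
    proof (cases "r < 0")
      case True
      with bounds have "AE x in M. indicator (L r) x = (0::real)"
        by (auto simp: L_def indicator_def elim!: eventually_mono)
      from real_cond_exp_cong[OF this] have "AE x in M. Q r x = real_cond_exp M G (\<lambda>_. 0) x"
        by (auto simp: Q_def)
      moreover have "AE x in M. real_cond_exp M G (\<lambda>_. 0) x = 0"
        by (rule real_cond_exp_F_meas) auto
      ultimately show ?thesis by eventually_elim simp
    qed auto
  qed
  moreover have "AE x in M. \<forall>r\<in>\<rat>. b \<le> r \<longrightarrow> Q r x = 1"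
  proof (intro AE_ball_countable[THEN iffD2] ballI countable_rat)
    fix r :: real
    show "AE x in M. b \<le> r \<longrightarrow> Q r x = 1"
    proof (cases "b \<le> r")
      case True
      have "AE x in M. indicator (L r) x = (1::real)"
        using bounds AE_space by eventually_elim (use True in \<open>auto simp: L_def indicator_def\<close>)
      from real_cond_exp_cong[OF this] have "AE x in M. Q r x = real_cond_exp M G (\<lambda>_. 1) x"
        by (auto simp: Q_def)
      moreover have "AE x in M. real_cond_exp M G (\<lambda>_. 1) x = 1"
        by (rule real_cond_exp_F_meas) auto
      ultimately show ?thesis by eventually_elim simp
    qed auto
  qed
  ultimately have Q_AE: "AE x in M. (\<forall>r\<in>\<rat>. \<forall>r'\<in>\<rat>. r \<le> r' \<longrightarrow> Q r x \<le> Q r' x)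
      \<and> (\<forall>r\<in>\<rat>. r < 0 \<longrightarrow> Q r x = 0) \<and> (\<forall>r\<in>\<rat>. b \<le> r \<longrightarrow> Q r x = 1)"
    by eventually_elim blast
  \<comment> \<open>Inserting \<open>b\<close> and confining the levels to \<open>[0, b]\<close>
    makes the set nonempty and bounded below at every point, even on the exceptional null set, so
    \<open>t\<close> is measurable and monotone in \<open>q\<close> everywhere.\<close>
  define K where "K q x = insert b {r \<in> \<rat>. 0 \<le> r \<and> r \<le> b \<and> q \<le> Q r x}" for q x
  define t where "t q x = Inf (K q x)" for q x
  have K_bdd: "bdd_below (K q x)" for q x
    by (rule bdd_belowI[of _ 0]) (use b in \<open>auto simp: K_def\<close>)
  have K_ne: "K q x \<noteq> {}" for q x by (auto simp: K_def)
  have t_less: "t q x < c \<longleftrightarrow> (\<exists>r\<in>K q x. r < c)" for q x c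
    unfolding t_def by (rule cInf_less_iff[OF K_ne K_bdd])
  have t_meas[measurable]: "t q \<in> borel_measurable G" for q
  proof (rule borel_measurableI_less)
    fix c
    have "{x \<in> space G. t q x < c} = (if b < c then space G else {}) \<union>
        (\<Union>r\<in>\<rat> \<inter> {0..b} \<inter> {..<c}. {x \<in> space G. q \<le> Q r x})"
      by (auto simp: t_less K_def)
    also have "\<dots> \<in> sets G"
      by (intro sets.Un sets.countable_UN'') (auto intro: countable_Int1 countable_rat)
    finally show "{x \<in> space G. t q x < c} \<in> sets G" .
  qed
  have t_measM[measurable]: "t q \<in> borel_measurable M" for q by (rule measurable_G[OF t_meas])
  have t_mono: "t q x \<le> t q' x" if "q \<le> q'" for q q' x
    unfolding t_def by (rule cInf_superset_mono[OF K_ne K_bdd]) (use that in \<open>auto simp: K_def\<close>)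
  have t_lower: "0 \<le> t q x" and t_upper: "t q x \<le> b" for q x
  proof -
    show "0 \<le> t q x" unfolding t_def by (rule cInf_greatest[OF K_ne]) (use b in \<open>auto simp: K_def\<close>)
    show "t q x \<le> b" unfolding t_def by (rule cInf_lower[OF _ K_bdd]) (auto simp: K_def)
  qed
  have main: "prob ({x \<in> space M. W x \<le> t q x} \<inter> A) = q * prob A"
    if q: "0 \<le> q" "q \<le> 1" and A: "A \<in> sets G" for q A
  proof (rule antisym)
    note [measurable] = A sets_G[OF A]
    have below: "AE x in M. \<forall>r\<in>\<rat>. r < t q x \<longrightarrow> Q r x \<le> q"
      using Q_AE
    proof eventually_elim
      case (elim x)
      show ?case
      proof (intro ballI impI)
        fix r :: real assume r: "r \<in> \<rat>" "r < t q x"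
        show "Q r x \<le> q"
        \<comment> \<open>Negative levels are outside \<open>K\<close> by construction, so their
          almost sure value 0 is used instead.\<close>
        proof (cases "r < 0")
          case True
          with elim r q show ?thesis by auto
        next
          case False
          have "r \<notin> K q x" using t_less[of q x] r cInf_lower[OF _ K_bdd[of q x], of r] by (auto simp: t_def)
          with False r t_upper[of q x] show ?thesis by (auto simp: K_def)
        qed
      qed
    qed
    have above: "AE x in M. \<forall>r\<in>\<rat>. t q x < r \<longrightarrow> q \<le> Q r x"
      using Q_AE
    proof eventually_elim
      case (elim x)
      show ?case
      proof (intro ballI impI)
        fix r :: real assume r: "r \<in> \<rat>" "t q x < r"
        then obtain r' where r': "r' \<in> K q x" "r' < r" using t_less by auto
        \<comment> \<open>The inserted element \<open>b\<close> is covered too: it is rational, and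
          \<open>Q b x = 1\<close> is at least \<open>q\<close>.\<close>
        then have "q \<le> Q r' x" "r' \<in> \<rat>" using q elim b by (auto simp: K_def)
        moreover have "Q r' x \<le> Q r x" using elim r r' \<open>r' \<in> \<rat>\<close> by auto
        ultimately show "q \<le> Q r x" by linarith
      qed
    qed
    \<comment> \<open>\<open>k n x / (n+1)\<close> and \<open>l n x / (n+1)\<close> approach \<open>t q x\<close> strictly from below and from above,
      with only finitely many values, so conditioning applies value by value.\<close>
    define k where "k n x = \<lceil>real (Suc n) * t q x\<rceil> - 1" for n x
    define l where "l n x = \<lfloor>real (Suc n) * t q x\<rfloor> + 1" for n x
    have k_meas[measurable]: "k n \<in> measurable G (count_space UNIV)" for n
      unfolding k_def by measurable
    have l_meas[measurable]: "l n \<in> measurable G (count_space UNIV)" for n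
      unfolding l_def by measurable
    note measM = measurable_from_subalg[OF sub k_meas] measurable_from_subalg[OF sub l_meas]
    note [measurable] = measM
    \<comment> \<open>The value -1 is taken by \<open>k\<close> where \<open>t q\<close> vanishes;
      the upper end leaves room for the increment in \<open>l\<close>.\<close>
    define J where "J n = {-1..\<lceil>real (Suc n) * b\<rceil> + 1}" for n
    have J: "finite (J n)" "k n x \<in> J n" "l n x \<in> J n" for n x
    proof -
      have "0 \<le> real (Suc n) * t q x" "real (Suc n) * t q x \<le> real (Suc n) * b"
        using t_lower[of q x] t_upper[of q x] by (auto intro: mult_left_mono)
      then show "k n x \<in> J n" "l n x \<in> J n"
        unfolding k_def l_def J_def atLeastAtMost_iff by linarith+
    qed (simp add: J_def)
    have k_less: "real_of_int (k n x) / real (Suc n) < t q x" for n x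
    proof -
      have "real_of_int (k n x) < real (Suc n) * t q x" unfolding k_def by linarith
      then show ?thesis by (simp add: pos_divide_less_eq mult.commute del: of_nat_Suc)
    qed
    have l_greater: "t q x < real_of_int (l n x) / real (Suc n)" for n x
    proof -
      have "real (Suc n) * t q x < real_of_int (l n x)" unfolding l_def by linarith
      then show ?thesis by (simp add: pos_less_divide_eq mult.commute del: of_nat_Suc)
    qed
    have k_near: "t q x - 1 / real (Suc n) \<le> real_of_int (k n x) / real (Suc n)" for n x
    proof -
      have "real (Suc n) * t q x - 1 \<le> real_of_int (k n x)" unfolding k_def by linarith
      then have "(real (Suc n) * t q x - 1) / real (Suc n) \<le> real_of_int (k n x) / real (Suc n)"
        by (rule divide_right_mono) simp
      then show ?thesis by (simp add: diff_divide_distrib del: of_nat_Suc)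
    qed
    have l_near: "real_of_int (l n x) / real (Suc n) \<le> t q x + 1 / real (Suc n)" for n x
    proof -
      have "real_of_int (l n x) \<le> real (Suc n) * t q x + 1" unfolding l_def by linarith
      then have "real_of_int (l n x) / real (Suc n) \<le> (real (Suc n) * t q x + 1) / real (Suc n)"
        by (rule divide_right_mono) simp
      then show ?thesis by (simp add: add_divide_distrib del: of_nat_Suc)
    qed
    have small: "eventually (\<lambda>n. 1 / real (Suc n) < e) sequentially" if "e > 0" for e
      using LIMSEQ_inverse_real_of_nat that by (auto simp: inverse_eq_divide dest: order_tendstoD(2))
    have cells: "prob (({x \<in> space M. W x \<le> real_of_int (f x) / real (Suc n)} \<inter> A)) =
        (\<Sum>j\<in>J n. prob (L (real_of_int j / real (Suc n)) \<inter> (A \<inter> {x \<in> space M. f x = j})))"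
      and cells_A: "prob A = (\<Sum>j\<in>J n. prob (A \<inter> {x \<in> space M. f x = j}))"
      if [measurable]: "f \<in> measurable M (count_space UNIV)" and f: "\<And>x. f x \<in> J n"
      for f :: "'a \<Rightarrow> int" and n
    proof -
      have "prob (({x \<in> space M. W x \<le> real_of_int (f x) / real (Suc n)} \<inter> A)) =
        (\<Sum>j\<in>J n. prob (({x \<in> space M. W x \<le> real_of_int (f x) / real (Suc n)} \<inter> A)
           \<inter> {x \<in> space M. f x = j}))"
        using f J(1) by (intro prob_finite_partition) auto
      also have "\<dots> = (\<Sum>j\<in>J n. prob (L (real_of_int j / real (Suc n)) \<inter> (A \<inter> {x \<in> space M. f x = j})))"
        by (intro sum.cong refl arg_cong[where f = prob]) (auto simp: L_def)
      finally show "prob (({x \<in> space M. W x \<le> real_of_int (f x) / real (Suc n)} \<inter> A)) =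
        (\<Sum>j\<in>J n. prob (L (real_of_int j / real (Suc n)) \<inter> (A \<inter> {x \<in> space M. f x = j})))" .
      show "prob A = (\<Sum>j\<in>J n. prob (A \<inter> {x \<in> space M. f x = j}))"
        using f J(1) by (intro prob_finite_partition) auto
    qed
    have rat: "real_of_int j / real (Suc n) \<in> \<rat>" for j n by simp
    have level_G: "A \<inter> {x \<in> space M. f x = j} \<in> sets G"
      if [measurable]: "f \<in> measurable G (count_space UNIV)" for f and j :: int
    proof -
      have "{x \<in> space G. f x = j} \<in> sets G" by measurable
      then show ?thesis by (auto simp: space_G)
    qed
    have le: "prob ({x \<in> space M. W x \<le> real_of_int (k n x) / real (Suc n)} \<inter> A) \<le> q * prob A" for n
    proof -
      have "prob (L (real_of_int j / real (Suc n)) \<inter> (A \<inter> {x \<in> space M. k n x = j}))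
          \<le> q * prob (A \<inter> {x \<in> space M. k n x = j})" for j
      proof (rule prob_Int_cond_le[OF L level_G[OF k_meas]])
        show "AE x in M. x \<in> A \<inter> {x \<in> space M. k n x = j} \<longrightarrow>
            real_cond_exp M G (indicator (L (real_of_int j / real (Suc n)))) x \<le> q"
          using below by eventually_elim (use k_less rat in \<open>auto simp: Q_def[symmetric]\<close>)
      qed
      then show ?thesis
        unfolding cells[OF measM(1) J(2)] cells_A[OF measM(1)[of n] J(2)] sum_distrib_left
        by (intro sum_mono)
    qed
    have ge: "q * prob A \<le> prob ({x \<in> space M. W x \<le> real_of_int (l n x) / real (Suc n)} \<inter> A)" for n
    proof -
      have "q * prob (A \<inter> {x \<in> space M. l n x = j}) \<le>
          prob (L (real_of_int j / real (Suc n)) \<inter> (A \<inter> {x \<in> space M. l n x = j}))" for j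
      proof (rule prob_Int_cond_ge[OF L level_G[OF l_meas]])
        show "AE x in M. x \<in> A \<inter> {x \<in> space M. l n x = j} \<longrightarrow>
            q \<le> real_cond_exp M G (indicator (L (real_of_int j / real (Suc n)))) x"
          using above by eventually_elim (use l_greater rat in \<open>auto simp: Q_def[symmetric]\<close>)
      qed
      then show ?thesis
        unfolding cells[OF measM(2) J(3)] cells_A[OF measM(2)[of n] J(3)] sum_distrib_left
        by (intro sum_mono)
    qed
    have "(\<lambda>n. prob ({x \<in> space M. W x \<le> real_of_int (k n x) / real (Suc n)} \<inter> A))
        \<longlonglongrightarrow> prob ({x \<in> space M. W x < t q x} \<inter> A)"
    proof (rule tendsto_prob_eventually_eq)
      fix x assume "x \<in> space M"
      show "\<forall>\<^sub>F n in sequentially. (x \<in> {x \<in> space M. W x \<le> real_of_int (k n x) / real (Suc n)} \<inter> A) \<longleftrightarrow>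
          (x \<in> {x \<in> space M. W x < t q x} \<inter> A)"
      proof (cases "W x < t q x")
        case True
        then have "t q x - W x > 0" by simp
        from small[OF this] show ?thesis
        proof eventually_elim
          case (elim n)
          then have "W x \<le> real_of_int (k n x) / real (Suc n)" using k_near[of x n] by linarith
          with True show ?case by simp
        qed
      next
        case False
        then have "\<not> W x \<le> real_of_int (k n x) / real (Suc n)" for n using k_less[of n x] by linarith
        with False show ?thesis by auto
      qed
    qed measurable
    then have "prob ({x \<in> space M. W x < t q x} \<inter> A) \<le> q * prob A"
      using le by (intro LIMSEQ_le_const2) auto
    \<comment> \<open>The approximation from below only reaches the strict inequality;
      \<open>atomless\<close> closes the gap.\<close>
    moreover have "prob ({x \<in> space M. W x \<le> t q x} \<inter> A)
        \<le> prob ({x \<in> space M. W x < t q x} \<inter> A) + prob {x \<in> space M. W x = t q x}"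
      by (rule order_trans[OF finite_measure_mono measure_Un_le]) auto
    ultimately show "prob ({x \<in> space M. W x \<le> t q x} \<inter> A) \<le> q * prob A"
      using atomless[OF t_meas[of q]] by simp
    have "(\<lambda>n. prob ({x \<in> space M. W x \<le> real_of_int (l n x) / real (Suc n)} \<inter> A))
        \<longlonglongrightarrow> prob ({x \<in> space M. W x \<le> t q x} \<inter> A)"
    proof (rule tendsto_prob_eventually_eq)
      fix x assume "x \<in> space M"
      show "\<forall>\<^sub>F n in sequentially. (x \<in> {x \<in> space M. W x \<le> real_of_int (l n x) / real (Suc n)} \<inter> A) \<longleftrightarrow>
          (x \<in> {x \<in> space M. W x \<le> t q x} \<inter> A)"
      proof (cases "W x \<le> t q x")
        case True
        then have "W x \<le> real_of_int (l n x) / real (Suc n)" for n using l_greater[of x n] by linarith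
        with True show ?thesis by auto
      next
        case False
        then have "W x - t q x > 0" by simp
        from small[OF this] show ?thesis
        proof eventually_elim
          case (elim n)
          then have "\<not> W x \<le> real_of_int (l n x) / real (Suc n)" using l_near[of n x] by linarith
          with False show ?case by simp
        qed
      qed
    qed measurable
    then show "q * prob A \<le> prob ({x \<in> space M. W x \<le> t q x} \<inter> A)"
      using ge by (intro LIMSEQ_le_const) auto
  qed
  show thesis by (rule that[OF t_meas t_mono main])
qed

section \<open>Independence of a sub-sigma-algebra and the uniform variable\<close>

lemma indep_of_algebraD:
  fixes Y :: "'a \<Rightarrow> 'b::topological_space"
  assumes "indep_of_algebra M Y G" "B \<in> sets borel" "A \<in> sets G"
  shows "prob ((Y -` B \<inter> space M) \<inter> A) = prob (Y -` B \<inter> space M) * prob A"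
  by (rule indep_setD[where A = "sets (vimage_algebra (space M) Y borel)" and B = "sets G"])
     (use assms in \<open>auto simp: indep_of_algebra_def intro: in_vimage_algebra\<close>)

lemma indep_of_algebraI:
  fixes Y :: "'a \<Rightarrow> 'b::topological_space"
  assumes Y: "Y \<in> borel_measurable M"
    and "\<And>B A. B \<in> sets borel \<Longrightarrow> A \<in> sets G \<Longrightarrow>
       prob ((Y -` B \<inter> space M) \<inter> A) = prob (Y -` B \<inter> space M) * prob A"
  shows "indep_of_algebra M Y G"
  unfolding indep_of_algebra_def
proof (intro conjI Y indep_setI)
  show "sets (vimage_algebra (space M) Y borel) \<subseteq> events"
    using Y by (auto simp: sets_vimage_algebra2 measurable_sets)
  show "sets G \<subseteq> events" using sets_G by auto
qed (use assms in \<open>auto simp: sets_vimage_algebra2\<close>)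

text \<open>The target \<open>t\<close> is rounded to a grid of mesh \<open>1 / (n + 1)\<close>. Its
  cell index is known to \<open>G\<close>, hence independent of \<open>U\<close>, which falls into
  any prescribed cell with probability at most the mesh. Summing over the cells bounds the
  probability by the mesh.\<close>

lemma uniform_atomless_given_subalgebra:
  assumes U: "U \<in> borel_measurable M" "distr M borel U = uniform_measure lborel {0..1::real}"
    and ind: "indep_of_algebra M U G" and t: "t \<in> borel_measurable G"
  shows "prob {x \<in> space M. U x = t x} = 0"
proof -
  note [measurable] = U(1) measurable_G[OF t]
  have unif: "prob (U -` B \<inter> space M) = measure lborel ({0..1} \<inter> B)" if "B \<in> sets borel" for B
    using measure_distr[OF U(1), of B] that by (simp add: U(2) measure_uniform_measure)
  have "prob {x \<in> space M. U x = t x} \<le> 1 / real (Suc n)" for n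
  proof -
    define k where "k x = \<lfloor>real (Suc n) * t x\<rfloor>" for x
    \<comment> \<open>Neighbouring closed cells overlap; disjointness of the events summed later
      comes from the values of \<open>k\<close>.\<close>
    define cell where "cell j = {real_of_int j / real (Suc n) .. real_of_int (j + 1) / real (Suc n)}" for j
    define J where "J = {- 1..int (Suc n)}"
    have k_meas[measurable]: "k \<in> measurable M (count_space UNIV)" unfolding k_def by measurable
    have kG: "{x \<in> space M. k x = j} \<in> sets G" for j
    proof -
      note [measurable] = t
      have "{x \<in> space G. \<lfloor>real (Suc n) * t x\<rfloor> = j} \<in> sets G" by measurable
      then show ?thesis by (simp add: k_def space_G)
    qed
    have t_cell: "t x \<in> cell (k x)" for x
      unfolding cell_def k_def atLeastAtMost_iff
      by (subst pos_divide_le_eq, simp, subst pos_le_divide_eq, simp) (simp add: mult.commute; linarith)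
    \<comment> \<open>Almost surely \<open>U\<close> lies in \<open>[0, 1]\<close>, so where
      \<open>U = t\<close> only finitely many cells occur; the index \<open>Suc n\<close> is taken
      where \<open>t\<close> is 1.\<close>
    have "prob {x \<in> space M. U x = t x} = prob {x \<in> space M. U x = t x \<and> 0 \<le> U x \<and> U x \<le> 1}"
    proof (rule finite_measure_eq_AE)
      have "AE x in distr M borel U. 0 \<le> x \<and> x \<le> 1"
        unfolding U(2) by (rule AE_uniform_measureI) auto
      then have "AE x in M. 0 \<le> U x \<and> U x \<le> 1" by (subst (asm) AE_distr_iff) auto
      then show "AE x in M. (x \<in> {x \<in> space M. U x = t x}) \<longleftrightarrow>
          (x \<in> {x \<in> space M. U x = t x \<and> 0 \<le> U x \<and> U x \<le> 1})"
        by eventually_elim auto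
    qed measurable
    also have "\<dots> \<le> prob (\<Union>j\<in>J. (U -` cell j \<inter> space M) \<inter> {x \<in> space M. k x = j})"
    proof (rule finite_measure_mono)
      show "{x \<in> space M. U x = t x \<and> 0 \<le> U x \<and> U x \<le> 1} \<subseteq>
          (\<Union>j\<in>J. (U -` cell j \<inter> space M) \<inter> {x \<in> space M. k x = j})"
      proof
        fix x assume x: "x \<in> {x \<in> space M. U x = t x \<and> 0 \<le> U x \<and> U x \<le> 1}"
        then have "0 \<le> real (Suc n) * t x" "real (Suc n) * t x \<le> real (Suc n) * 1"
          by (auto intro!: mult_left_mono simp del: of_nat_Suc)
        then have "0 \<le> k x" "k x \<le> \<lfloor>real (Suc n)\<rfloor>"
          unfolding k_def by (simp_all only: zero_le_floor mult_1_right floor_mono)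
        then have "k x \<in> J" by (simp add: J_def)
        with x t_cell[of x] show "x \<in> (\<Union>j\<in>J. (U -` cell j \<inter> space M) \<inter> {x \<in> space M. k x = j})"
          by auto
      qed
      show "(\<Union>j\<in>J. (U -` cell j \<inter> space M) \<inter> {x \<in> space M. k x = j}) \<in> events"
        by (auto simp: J_def cell_def intro!: measurable_sets[OF U(1)])
    qed
    also have "\<dots> = (\<Sum>j\<in>J. prob ((U -` cell j \<inter> space M) \<inter> {x \<in> space M. k x = j}))"
      by (rule finite_measure_finite_Union)
         (auto simp: J_def cell_def disjoint_family_on_def intro!: measurable_sets[OF U(1)])
    also have "\<dots> = (\<Sum>j\<in>J. prob (U -` cell j \<inter> space M) * prob {x \<in> space M. k x = j})"
      by (intro sum.cong refl indep_of_algebraD[OF ind] kG) (simp add: cell_def)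
    also have "\<dots> \<le> (\<Sum>j\<in>J. 1 / real (Suc n) * prob {x \<in> space M. k x = j})"
    proof (intro sum_mono mult_right_mono)
      fix j
      have "measure lborel ({0..1} \<inter> cell j) \<le> measure lborel (cell j)"
        by (rule measure_mono_fmeasurable) (auto simp: cell_def emeasure_lborel_Icc_eq intro!: fmeasurableI)
      also have "\<dots> = 1 / real (Suc n)"
        by (simp add: cell_def divide_right_mono diff_divide_distrib[symmetric] del: of_nat_Suc)
      finally show "prob (U -` cell j \<inter> space M) \<le> 1 / real (Suc n)"
        by (subst unif) (simp_all add: cell_def)
    qed simp
    also have "\<dots> = 1 / real (Suc n) * prob (\<Union>j\<in>J. {x \<in> space M. k x = j})"
      unfolding sum_distrib_left[symmetric]
      by (subst finite_measure_finite_Union) (auto simp: J_def disjoint_family_on_def)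
    also have "\<dots> \<le> 1 / real (Suc n) * 1"
      by (intro mult_left_mono) auto
    finally show ?thesis by simp
  qed
  moreover have "(\<lambda>n. 1 / real (Suc n)) \<longlonglongrightarrow> 0"
    using LIMSEQ_inverse_real_of_nat by (simp add: inverse_eq_divide)
  ultimately have "prob {x \<in> space M. U x = t x} \<le> 0" by (intro LIMSEQ_le_const) auto
  then show ?thesis using measure_nonneg[of M] by (intro antisym)
qed

end

subsection \<open>Expansion of one increment\<close>

text \<open>One time step: \<open>G\<close> is the past, \<open>H\<close> the information after the
  step, and \<open>U\<close> the fresh randomness revealed by it.\<close>

locale prob_step = prob_subalgebra M G for M G :: "'a measure" +
  fixes H :: "'a measure" and U :: "'a \<Rightarrow> real"
  assumes sub_H: "subalgebra M H" and sub_HG: "subalgebra H G"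
    and U_H: "U \<in> borel_measurable H"
    and U_unif: "distr M borel U = uniform_measure lborel {0..1}"
    and U_ind: "indep_of_algebra M U G"
begin

lemma space_H: "space H = space M"
  using sub_H by (simp add: subalgebra_def)

lemma sets_H: "A \<in> sets H \<Longrightarrow> A \<in> sets M"
  using sub_H by (auto simp: subalgebra_def)

lemma sets_G_H: "A \<in> sets G \<Longrightarrow> A \<in> sets H"
  using sub_HG by (auto simp: subalgebra_def)

lemma measurable_H: "f \<in> borel_measurable H \<Longrightarrow> f \<in> borel_measurable M"
  by (rule measurable_from_subalg[OF sub_H])

lemma AE_U: "AE x in M. 0 \<le> U x \<and> U x \<le> 1"
proof -
  have "AE x in distr M borel U. 0 \<le> x \<and> x \<le> 1"
    unfolding U_unif by (rule AE_uniform_measureI) auto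
  then show ?thesis using measurable_H[OF U_H] by (subst (asm) AE_distr_iff) auto
qed

definition indep_events_H :: "'a set set" where
  "indep_events_H = {E \<in> sets H. \<forall>A\<in>sets G. prob (E \<inter> A) = prob E * prob A}"

text \<open>The slices \<open>C i\<close> lie between consecutive conditional
  \<open>N\<close>-quantiles of a variable \<open>W\<close> for which \<open>B\<close> is, up to
  null sets, the event \<open>W \<le> 1\<close>. Where the upper quantile is at most 1 the slice
  lies in \<open>B\<close>; where the lower one exceeds 1 it misses \<open>B\<close>. Both
  conditions are decided by \<open>G\<close>, and at each point at most one slice straddles the
  level 1.\<close>

lemma equipartition:
  assumes B: "B \<in> sets H" and N: "N > 0"
  obtains C A :: "nat \<Rightarrow> 'a set"
  where "\<And>i. i < N \<Longrightarrow> C i \<in> sets H" "\<And>i. A i \<in> sets G"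
    "\<And>i A'. i < N \<Longrightarrow> A' \<in> sets G \<Longrightarrow> prob (C i \<inter> A') = prob A' / real N"
    "AE x in M. (\<Sum>i<N. indicator (C i) x) = (1::real)"
    "B - (\<Union>i<N. C i \<inter> A i) \<in> sets M"
    "prob (B - (\<Union>i<N. C i \<inter> A i)) \<le> 1 / real N"
    "AE x in M. indicator B x =
       (\<Sum>i<N. indicator (C i \<inter> A i) x) + (indicator (B - (\<Union>i<N. C i \<inter> A i)) x :: real)"
proof -
  \<comment> \<open>The shift by 2 separates the values on \<open>B\<close>, almost surely in
    \<open>[0, 1]\<close>, from those off \<open>B\<close>, in \<open>[2, 3]\<close>.\<close>
  define W where "W x = (if x \<in> B then U x else U x + 2)" for x
  note [measurable] = B U_H
  have W_H[measurable]: "W \<in> borel_measurable H"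
    unfolding W_def by measurable
  note W_M[measurable] = measurable_H[OF W_H]
  note U_M[measurable] = measurable_H[OF U_H]
  have "AE x in M. 0 \<le> W x \<and> W x \<le> 3"
    using AE_U by eventually_elim (auto simp: W_def)
  moreover have "prob {x \<in> space M. W x = t x} = 0" if t: "t \<in> borel_measurable G" for t
  proof -
    note [measurable] = measurable_G[OF t]
    \<comment> \<open>A tie \<open>W = t\<close> forces \<open>U = t\<close> or
      \<open>U = t - 2\<close>, and both targets are measurable for \<open>G\<close>.\<close>
    have "prob {x \<in> space M. W x = t x} \<le>
        prob {x \<in> space M. U x = t x} + prob {x \<in> space M. U x = t x - 2}"
      by (rule order_trans[OF finite_measure_mono measure_Un_le])
         (auto simp: W_def split: if_splits)
    also have "\<dots> = 0"
      using uniform_atomless_given_subalgebra[OF U_M U_unif U_ind, of t]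
        uniform_atomless_given_subalgebra[OF U_M U_unif U_ind, of "\<lambda>x. t x - 2"] t
      by simp
    finally show ?thesis by (simp add: measure_le_0_iff)
  qed
  ultimately obtain t where t: "\<And>q. t q \<in> borel_measurable G" "\<And>q q' x. q \<le> q' \<Longrightarrow> t q x \<le> t q' x"
    and t_prob: "\<And>q A. 0 \<le> q \<Longrightarrow> q \<le> 1 \<Longrightarrow> A \<in> sets G \<Longrightarrow>
       prob ({x \<in> space M. W x \<le> t q x} \<inter> A) = q * prob A"
    using conditional_quantile[OF W_M, of 3] by auto
  define \<tau> where "\<tau> i = t (real i / real N)" for i
  define T where "T i = {x \<in> space M. W x \<le> \<tau> i x}" for i
  have \<tau>_mono: "\<tau> i x \<le> \<tau> j x" if "i \<le> j" for i j x
    unfolding \<tau>_def by (rule t(2)) (use that in \<open>auto intro: divide_right_mono\<close>)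
  have T_mono: "T i \<subseteq> T j" if "i \<le> j" for i j
    unfolding T_def using \<tau>_mono[OF that] by (auto intro: order_trans)
  have \<tau>_G[measurable]: "\<tau> i \<in> borel_measurable G" for i unfolding \<tau>_def by (rule t)
  have \<tau>_H[measurable]: "\<tau> i \<in> borel_measurable H" for i by (rule measurable_from_subalg[OF sub_HG \<tau>_G])
  have T_H: "T i \<in> sets H" for i
  proof -
    have "{x \<in> space H. W x \<le> \<tau> i x} \<in> sets H" by measurable
    then show ?thesis by (simp add: T_def space_H)
  qed
  have T_prob: "prob (T i \<inter> A) = real i / real N * prob A" if "i \<le> N" "A \<in> sets G" for i A
    unfolding T_def \<tau>_def by (rule t_prob) (use that N in \<open>auto simp: field_simps\<close>)
  define C where "C i = T (Suc i) - T i" for i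
  define A where "A i = {x \<in> space M. \<tau> i x \<le> 1}" for i
  have A_G: "A i \<in> sets G" for i
  proof -
    have "{x \<in> space G. \<tau> i x \<le> 1} \<in> sets G" by measurable
    then show ?thesis by (simp add: A_def space_G)
  qed
  have C_H: "C i \<in> sets H" for i unfolding C_def by (intro sets.Diff T_H)
  have C_prob: "prob (C i \<inter> A') = prob A' / real N" if "i < N" "A' \<in> sets G" for i A'
  proof -
    have "C i \<inter> A' = (T (Suc i) \<inter> A') - (T i \<inter> A')" by (auto simp: C_def)
    then have "prob (C i \<inter> A') = prob (T (Suc i) \<inter> A') - prob (T i \<inter> A')"
      using T_mono[of i "Suc i"] sets_H[OF T_H] sets_G[OF that(2)]
      by (simp only:) (rule finite_measure_Diff, auto)
    also have "\<dots> = prob A' / real N"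
      using that by (simp add: T_prob field_simps)
    finally show ?thesis .
  qed
  \<comment> \<open>The extreme quantile events are null and full, so the telescoping sum of the
    slices is 1 almost everywhere.\<close>
  have "prob (T 0) = 0" "prob (T N) = 1"
    using T_prob[of 0 "space M"] T_prob[of N "space M"] sets.top[of G] N sets.sets_into_space[OF sets_H[OF T_H]]
    by (simp_all add: space_G Int_absorb2 prob_space)
  then have T_0_N: "AE x in M. x \<notin> T 0" "AE x in M. x \<in> T N"
    using sets_H[OF T_H] by (simp_all add: prob_eq_0 prob_eq_1)
  have sum_C: "(\<Sum>i<n. indicator (C i) x) = (indicator (T n) x - indicator (T 0) x :: real)" for n x
  proof (induction n)
    case (Suc n)
    then show ?case using T_mono[of n "Suc n"] by (auto simp: C_def indicator_def)
  qed simp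
  have C_part: "AE x in M. (\<Sum>i<N. indicator (C i) x) = (1::real)"
    using T_0_N by eventually_elim (simp add: sum_C)
  have C_disj: "x \<notin> C j" if "x \<in> C i" "i < j" for x i j
    using that T_mono[of "Suc i" j] by (auto simp: C_def)
  define E where "E = (\<Union>i<N. C i \<inter> A (Suc i))"
  have E_M: "E \<in> sets M"
    unfolding E_def using C_H A_G sets_H sets_G by (intro sets.finite_UN sets.Int) auto
  have B_M: "B \<in> sets M" by (rule sets_H[OF B])
  have E_B: "AE x in M. x \<in> E \<longrightarrow> x \<in> B"
    using AE_U
  proof eventually_elim
    case (elim x)
    show ?case
    proof
      assume "x \<in> E"
      then have "W x \<le> 1" by (auto simp: E_def C_def T_def A_def)
      with elim show "x \<in> B" by (auto simp: W_def split: if_splits)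
    qed
  qed
  have sum_E: "(\<Sum>i<N. indicator (C i \<inter> A (Suc i)) x) = (indicator E x :: real)" for x
    unfolding E_def
  proof (rule indicator_UN_disjoint[symmetric])
    show "disjoint_family_on (\<lambda>i. C i \<inter> A (Suc i)) {..<N}"
      unfolding disjoint_family_on_def using C_disj by (metis Int_iff disjoint_iff linorder_neqE_nat)
  qed simp
  have decomp: "AE x in M. indicator B x = (\<Sum>i<N. indicator (C i \<inter> A (Suc i)) x) + (indicator (B - E) x :: real)"
    unfolding sum_E using E_B by eventually_elim (auto simp: indicator_def)
  have A_anti: "A (Suc i) \<subseteq> A i" for i
    using \<tau>_mono[of i "Suc i"] by (auto simp: A_def intro: order_trans)
  \<comment> \<open>A point of \<open>B\<close> in slice \<open>i\<close> has
    \<open>\<tau> i < W \<le> 1\<close>; it escapes \<open>E\<close> only if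
    \<open>\<tau> (Suc i)\<close> exceeds 1, that is, if its slice straddles the level 1.\<close>
  have "prob (B - E) \<le> prob (\<Union>i<N. C i \<inter> (A i - A (Suc i)))"
  proof (rule finite_measure_mono_AE)
    show "(\<Union>i<N. C i \<inter> (A i - A (Suc i))) \<in> events"
      using C_H A_G sets_H sets_G by (intro sets.finite_UN sets.Int sets.Diff) auto
    show "AE x in M. x \<in> B - E \<longrightarrow> x \<in> (\<Union>i<N. C i \<inter> (A i - A (Suc i)))"
      using AE_U C_part AE_space
    proof eventually_elim
      case (elim x)
      show ?case
      proof
        assume x: "x \<in> B - E"
        have "\<exists>i<N. x \<in> C i"
        proof (rule ccontr)
          assume "\<not> (\<exists>i<N. x \<in> C i)"
          then have "(\<Sum>i<N. indicator (C i) x) = (0::real)" by (intro sum.neutral) auto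
          with elim show False by simp
        qed
        then obtain i where i: "i < N" "x \<in> C i" by blast
        moreover have "x \<notin> A (Suc i)" using x i by (auto simp: E_def)
        moreover have "\<tau> i x \<le> 1" using i x elim by (auto simp: C_def T_def W_def)
        ultimately show "x \<in> (\<Union>i<N. C i \<inter> (A i - A (Suc i)))" using elim by (auto simp: A_def)
      qed
    qed
  qed
  also have "\<dots> \<le> (\<Sum>i<N. prob (C i \<inter> (A i - A (Suc i))))"
    using C_H A_G sets_H sets_G by (intro finite_measure_subadditive_finite) auto
  \<comment> \<open>\<open>A i - A (Suc i)\<close> belongs to \<open>G\<close>, so intersecting with
    \<open>C i\<close> costs the factor \<open>1 / N\<close>; as \<open>A\<close> decreases, the sum
    telescopes.\<close>
  also have "\<dots> = (\<Sum>i<N. (prob (A i) - prob (A (Suc i))) / real N)"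
  proof (rule sum.cong[OF refl])
    fix i assume "i \<in> {..<N}"
    then have "prob (C i \<inter> (A i - A (Suc i))) = prob (A i - A (Suc i)) / real N"
      using A_G by (intro C_prob) auto
    also have "prob (A i - A (Suc i)) = prob (A i) - prob (A (Suc i))"
      using sets_G[OF A_G] A_anti by (intro finite_measure_Diff) auto
    finally show "prob (C i \<inter> (A i - A (Suc i))) = (prob (A i) - prob (A (Suc i))) / real N" .
  qed
  also have "\<dots> = (prob (A 0) - prob (A N)) / real N"
    unfolding sum_divide_distrib[symmetric]
    by (simp only: sum_lessThan_telescope'[of "\<lambda>i. prob (A i)" N])
  also have "\<dots> \<le> 1 / real N"
    using measure_nonneg[of M "A N"] prob_le_1[of "A 0"] by (intro divide_right_mono) linarith+
  finally have small: "prob (B - E) \<le> 1 / real N" .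
  show thesis
  \<comment> \<open>The index is shifted because the upper end of slice \<open>C i\<close> is the
    quantile \<open>\<tau> (Suc i)\<close>.\<close>
  proof (rule that[of C "\<lambda>i. A (Suc i)"])
    show "B - (\<Union>i<N. C i \<inter> A (Suc i)) \<in> events" using B_M E_M by (simp add: E_def)
  qed (use C_H A_G C_prob C_part small decomp in \<open>simp_all add: E_def\<close>)
qed

section \<open>From independent events to all events of \<open>H\<close>\<close>

text \<open>Each of the \<open>N\<close> pieces \<open>C i \<inter> A i\<close> contributes at most
  \<open>2 * \<delta>\<close>. The undecided part of \<open>B\<close> has probability at most
  \<open>1 / N\<close> and contributes the second summand, which is uniform over \<open>R\<close>
  bounded in the square mean.\<close>

lemma integral_event_bound:
  fixes R :: "'a \<Rightarrow> real"
  assumes R[measurable]: "R \<in> borel_measurable M" and R2: "integrable M (\<lambda>x. (R x)\<^sup>2)"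
    and orth: "\<And>A. A \<in> sets G \<Longrightarrow> (\<integral>x. indicator A x * R x \<partial>M) = 0"
    and small: "\<And>E. E \<in> indep_events_H \<Longrightarrow> \<bar>\<integral>x. indicator E x * R x \<partial>M\<bar> \<le> \<delta>"
    and B: "B \<in> sets H" and N: "N > 0"
  shows "\<bar>\<integral>x. indicator B x * R x \<partial>M\<bar> \<le> 2 * real N * \<delta> + (1 + (\<integral>x. (R x)\<^sup>2 \<partial>M)) / sqrt (real N)"
proof -
  obtain C A :: "nat \<Rightarrow> 'a set" where C: "\<And>i. i < N \<Longrightarrow> C i \<in> sets H" and A: "\<And>i. A i \<in> sets G"
    and CA: "\<And>i A'. i < N \<Longrightarrow> A' \<in> sets G \<Longrightarrow> prob (C i \<inter> A') = prob A' / real N"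
    and part: "AE x in M. (\<Sum>i<N. indicator (C i) x) = (1::real)"
    and rest: "B - (\<Union>i<N. C i \<inter> A i) \<in> sets M" "prob (B - (\<Union>i<N. C i \<inter> A i)) \<le> 1 / real N"
    and dec: "AE x in M. indicator B x =
       (\<Sum>i<N. indicator (C i \<inter> A i) x) + (indicator (B - (\<Union>i<N. C i \<inter> A i)) x :: real)"
    using equipartition[OF B N] by blast
  have R_int: "integrable M R"
    by (rule square_integrable_imp_integrable[OF R R2])
  have ER_int[simp]: "integrable M (\<lambda>x. indicator E x * R x)" if "E \<in> sets M" for E
    using integrable_mult_indicator[OF that R_int] by simp
  have C_indep: "C i \<in> indep_events_H" if "i < N" for i
  proof -
    have "prob (C i) = 1 / real N"
      using CA[OF that sets.top] sets.sets_into_space[OF sets_H[OF C[OF that]]]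
      by (simp add: space_G prob_space Int_absorb2)
    with that C CA show ?thesis by (auto simp: indep_events_H_def)
  qed
  have I: "\<bar>\<integral>x. indicator (C i \<inter> A') x * R x \<partial>M\<bar> \<le> 2 * \<delta>" if i: "i < N" and A': "A' \<in> sets G" for i A'
  proof -
    define J where "J l = (\<integral>x. indicator (C l \<inter> A') x * R x \<partial>M)" for l
    have CM: "C l \<in> sets M" "C l \<inter> A' \<in> sets M" if "l < N" for l
      using sets_H[OF C[OF that]] sets_G[OF A'] by auto
    have swap: "\<bar>J i - J l\<bar> \<le> 2 * \<delta>" if l: "l < N" for l
    proof -
      \<comment> \<open>On \<open>A'\<close> this event agrees with \<open>C i\<close> and off
        \<open>A'\<close> with \<open>C l\<close>; both have conditional probability
        \<open>1 / N\<close>, so \<open>E\<close> is independent of \<open>G\<close>. Its integral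
        differs from that of \<open>C l\<close> by exactly \<open>J i - J l\<close>, so two
        applications of \<open>small\<close> suffice.\<close>
      define E where "E = (C i \<inter> A') \<union> (C l - A')"
      have EH: "E \<in> sets H" using C[OF i] C[OF l] sets_G_H[OF A'] by (auto simp: E_def)
      have EA: "prob (E \<inter> A'') = prob A'' / real N" if A'': "A'' \<in> sets G" for A''
      proof -
        have "E \<inter> A'' = (C i \<inter> (A' \<inter> A'')) \<union> (C l \<inter> (A'' - A'))" by (auto simp: E_def)
        then have "prob (E \<inter> A'') = prob (C i \<inter> (A' \<inter> A'')) + prob (C l \<inter> (A'' - A'))"
          using CM[OF i] CM[OF l] sets_G[OF A'] sets_G[OF A'']
          by (simp only:) (rule finite_measure_Union, auto)
        also have "\<dots> = (prob (A' \<inter> A'') + prob (A'' - A')) / real N"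
          using A' A'' by (simp add: CA i l add_divide_distrib)
        also have "prob (A' \<inter> A'') + prob (A'' - A') = prob ((A' \<inter> A'') \<union> (A'' - A'))"
          using sets_G[OF A'] sets_G[OF A''] by (intro finite_measure_Union[symmetric]) auto
        also have "(A' \<inter> A'') \<union> (A'' - A') = A''" by auto
        finally show ?thesis .
      qed
      have "prob E = 1 / real N"
        using EA[OF sets.top] sets.sets_into_space[OF sets_H[OF EH]]
        by (simp add: space_G prob_space Int_absorb2)
      with EH EA have E_indep: "E \<in> indep_events_H" by (auto simp: indep_events_H_def)
      have "(\<integral>x. indicator E x * R x \<partial>M) =
        (\<integral>x. indicator (C i \<inter> A') x * R x - indicator (C l \<inter> A') x * R x + indicator (C l) x * R x \<partial>M)"
        by (intro Bochner_Integration.integral_cong) (auto simp: E_def indicator_def)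
      also have "\<dots> = J i - J l + (\<integral>x. indicator (C l) x * R x \<partial>M)"
        using CM[OF i] CM[OF l] by (simp add: J_def)
      finally show ?thesis using small[OF E_indep] small[OF C_indep[OF l]] by linarith
    qed
    \<comment> \<open>The \<open>J l\<close> add up to the integral over \<open>A'\<close>, which
      vanishes; hence \<open>J i\<close> is the average of the differences
      \<open>J i - J l\<close>.\<close>
    have "(\<Sum>l<N. J l) = (\<integral>x. (\<Sum>l<N. indicator (C l \<inter> A') x * R x) \<partial>M)"
      unfolding J_def by (rule Bochner_Integration.integral_sum[symmetric]) (use CM in auto)
    also have "\<dots> = (\<integral>x. indicator A' x * R x \<partial>M)"
    proof (rule integral_cong_AE)
      show "AE x in M. (\<Sum>l<N. indicator (C l \<inter> A') x * R x) = indicator A' x * R x"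
        using part
      proof eventually_elim
        case (elim x)
        have "(\<Sum>l<N. indicator (C l \<inter> A') x * R x) = (\<Sum>l<N. indicator (C l) x) * (indicator A' x * R x)"
          by (simp add: indicator_inter_arith sum_distrib_right mult.assoc)
        with elim show ?case by simp
      qed
      show "(\<lambda>x. \<Sum>l<N. indicator (C l \<inter> A') x * R x) \<in> borel_measurable M"
        using CM by (intro borel_measurable_sum borel_measurable_times R borel_measurable_indicator) auto
      show "(\<lambda>x. indicator A' x * R x) \<in> borel_measurable M"
        using sets_G[OF A'] by measurable
    qed
    also have "\<dots> = 0" by (rule orth[OF A'])
    finally have "real N * J i = (\<Sum>l<N. J i - J l)" by (simp add: sum_subtractf)
    then have "\<bar>real N * J i\<bar> \<le> (\<Sum>l<N. \<bar>J i - J l\<bar>)" by simp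
    also have "\<dots> \<le> (\<Sum>l<N. 2 * \<delta>)" by (intro sum_mono swap) simp
    finally show ?thesis using N by (simp add: abs_mult J_def[symmetric])
  qed
  define V where "V = B - (\<Union>i<N. C i \<inter> A i)"
  have V: "V \<in> sets M" "prob V \<le> 1 / real N" using rest by (simp_all add: V_def)
  have CAM: "C i \<inter> A i \<in> sets M" if "i < N" for i
    using sets_H[OF C[OF that]] sets_G[OF A] by auto
  have "(\<integral>x. indicator B x * R x \<partial>M) =
      (\<integral>x. (\<Sum>i<N. indicator (C i \<inter> A i) x * R x) + indicator V x * R x \<partial>M)"
  proof (rule integral_cong_AE)
    show "AE x in M. indicator B x * R x = (\<Sum>i<N. indicator (C i \<inter> A i) x * R x) + indicator V x * R x"
      using dec by eventually_elim (simp add: V_def sum_distrib_right distrib_right)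
    show "(\<lambda>x. indicator B x * R x) \<in> borel_measurable M"
      using sets_H[OF B] by measurable
    show "(\<lambda>x. (\<Sum>i<N. indicator (C i \<inter> A i) x * R x) + indicator V x * R x) \<in> borel_measurable M"
      using CAM V(1)
      by (intro borel_measurable_add borel_measurable_sum borel_measurable_times R borel_measurable_indicator) auto
  qed
  also have "\<dots> = (\<Sum>i<N. \<integral>x. indicator (C i \<inter> A i) x * R x \<partial>M) + (\<integral>x. indicator V x * R x \<partial>M)"
    using CAM V(1) by (subst Bochner_Integration.integral_add)
      (auto intro!: Bochner_Integration.integral_sum Bochner_Integration.integrable_sum
         simp del: sum_indicator_mult sum_mult_indicator)
  finally have "\<bar>\<integral>x. indicator B x * R x \<partial>M\<bar> \<le>
      (\<Sum>i<N. \<bar>\<integral>x. indicator (C i \<inter> A i) x * R x \<partial>M\<bar>) + \<bar>\<integral>x. indicator V x * R x \<partial>M\<bar>"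
    using sum_abs[of "\<lambda>i. \<integral>x. indicator (C i \<inter> A i) x * R x \<partial>M" "{..<N}"] by linarith
  also have "(\<Sum>i<N. \<bar>\<integral>x. indicator (C i \<inter> A i) x * R x \<partial>M\<bar>) \<le> (\<Sum>i<N. 2 * \<delta>)"
    by (intro sum_mono I A) simp
  also have "\<bar>\<integral>x. indicator V x * R x \<partial>M\<bar> \<le> (1 + (\<integral>x. (R x)\<^sup>2 \<partial>M)) / sqrt (real N)"
  proof -
    \<comment> \<open>In \<open>\<bar>R\<bar> \<le> s + R\<^sup>2 / s\<close> on \<open>V\<close>,
      this weight balances \<open>s * prob V \<le> s / N\<close> against
      \<open>1 / s\<close>.\<close>
    define s where "s = sqrt (real N)"
    have s: "s > 0" "s * s = real N" using N by (auto simp: s_def)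
    have "\<bar>\<integral>x. indicator V x * R x \<partial>M\<bar> \<le> (\<integral>x. \<bar>indicator V x * R x\<bar> \<partial>M)"
      by (rule integral_abs_bound)
    also have "\<dots> \<le> (\<integral>x. s * indicator V x + (R x)\<^sup>2 / s \<partial>M)"
    proof (rule integral_mono)
      fix x
      have "(s - \<bar>R x\<bar>)\<^sup>2 = s * s - 2 * (s * \<bar>R x\<bar>) + (R x)\<^sup>2"
        by (simp add: power2_diff power2_eq_square[of s])
      moreover have "0 \<le> (s - \<bar>R x\<bar>)\<^sup>2" "0 \<le> s * \<bar>R x\<bar>" using s(1) by auto
      ultimately have "s * \<bar>R x\<bar> \<le> s * s + (R x)\<^sup>2" by linarith
      then have "\<bar>R x\<bar> \<le> s + (R x)\<^sup>2 / s"
        using s(1) by (simp add: field_simps)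
      then show "\<bar>indicator V x * R x\<bar> \<le> s * indicator V x + (R x)\<^sup>2 / s"
        using s(1) by (auto simp: indicator_def)
    qed (use V R2 in \<open>auto intro!: integrable_indicator_event\<close>)
    also have "\<dots> = s * prob V + (\<integral>x. (R x)\<^sup>2 \<partial>M) / s"
      using V R2 integrable_indicator_event[OF V(1)] by simp
    also have "s * prob V \<le> 1 / s"
    proof -
      have "s * (s * prob V) \<le> 1"
        using V(2) N unfolding mult.assoc[symmetric] s(2) by (simp add: field_simps)
      then show ?thesis using s(1) by (simp add: pos_le_divide_eq mult.commute)
    qed
    finally show ?thesis by (simp add: s_def add_divide_distrib)
  qed
  finally show ?thesis by simp
qed

text \<open>First \<open>N\<close> is chosen, depending only on \<open>K\<close> and
  \<open>e\<close>, to make the undecided part small for all \<open>n\<close>; only then is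
  \<open>n\<close> taken large enough for \<open>2 * N * \<delta> n\<close>.\<close>

lemma integral_event_tendsto_0:
  fixes R :: "nat \<Rightarrow> 'a \<Rightarrow> real"
  assumes R: "\<And>n. R n \<in> borel_measurable M" and R2: "\<And>n. integrable M (\<lambda>x. (R n x)\<^sup>2)"
    and bound: "\<And>n. (\<integral>x. (R n x)\<^sup>2 \<partial>M) \<le> K"
    and orth: "\<And>n A. A \<in> sets G \<Longrightarrow> (\<integral>x. indicator A x * R n x \<partial>M) = 0"
    and small: "\<And>n E. E \<in> indep_events_H \<Longrightarrow> \<bar>\<integral>x. indicator E x * R n x \<partial>M\<bar> \<le> \<delta> n"
    and \<delta>: "\<delta> \<longlonglongrightarrow> 0" and B: "B \<in> sets H"
  shows "(\<lambda>n. \<integral>x. indicator B x * R n x \<partial>M) \<longlonglongrightarrow> 0"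
proof (rule LIMSEQ_I)
  fix e :: real assume e: "e > 0"
  have "(\<lambda>N. (1 + K) * inverse (sqrt (real N))) \<longlonglongrightarrow> (1 + K) * 0"
    by (intro tendsto_intros tendsto_inverse_0_at_top
        filterlim_compose[OF sqrt_at_top filterlim_real_sequentially])
  then have "eventually (\<lambda>N. (1 + K) * inverse (sqrt (real N)) < e / 2) sequentially"
    using e by (intro order_tendstoD(2)) auto
  \<comment> \<open>Positivity of \<open>N\<close> has to be requested separately: at
    \<open>N = 0\<close> the convention \<open>inverse 0 = 0\<close> makes the inequality
    true.\<close>
  with eventually_gt_at_top[of 0] have "eventually (\<lambda>N. 0 < N \<and> (1 + K) * inverse (sqrt (real N)) < e / 2) sequentially"
    by eventually_elim simp
  then obtain N where N: "N > 0" "(1 + K) * inverse (sqrt (real N)) < e / 2"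
    using eventually_happens'[OF sequentially_bot] by blast
  have "(\<lambda>n. 2 * real N * \<delta> n) \<longlonglongrightarrow> 2 * real N * 0" by (intro tendsto_intros \<delta>)
  then have "eventually (\<lambda>n. 2 * real N * \<delta> n < e / 2) sequentially"
    using e by (intro order_tendstoD(2)) auto
  then obtain n0 where n0: "\<And>n. n \<ge> n0 \<Longrightarrow> 2 * real N * \<delta> n < e / 2"
    by (auto simp: eventually_sequentially)
  have "\<bar>\<integral>x. indicator B x * R n x \<partial>M\<bar> < e" if "n \<ge> n0" for n
  proof -
    have "\<bar>\<integral>x. indicator B x * R n x \<partial>M\<bar> \<le> 2 * real N * \<delta> n + (1 + (\<integral>x. (R n x)\<^sup>2 \<partial>M)) / sqrt (real N)"
      using orth small by (intro integral_event_bound R R2 B N(1)) blast+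
    also have "(1 + (\<integral>x. (R n x)\<^sup>2 \<partial>M)) / sqrt (real N) \<le> (1 + K) / sqrt (real N)"
      using bound[of n] by (intro divide_right_mono) auto
    finally show ?thesis using N(2)[folded divide_inverse] n0[OF that] by linarith
  qed
  then show "\<exists>no. \<forall>n\<ge>no. norm ((\<integral>x. indicator B x * R n x \<partial>M) - 0) < e" by auto
qed

text \<open>Pointwise simple approximants can be chosen with norm at most twice that of
  \<open>D\<close>, so dominated convergence upgrades pointwise to \<open>L\<^sup>2\<close>
  convergence.\<close>

lemma simple_L2_approximation:
  fixes D :: "'a \<Rightarrow> real ^ 'm"
  assumes D: "D \<in> borel_measurable H" "square_integrable M D" and e: "e > 0"
  obtains s where "simple_function H s" "square_integrable M s" "L2_norm M (\<lambda>x. D x - s x) < e"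
proof -
  obtain F where F: "\<And>i. simple_function H (F i)" "\<And>x. x \<in> space M \<Longrightarrow> (\<lambda>i. F i x) \<longlonglongrightarrow> D x"
    "\<And>i x. x \<in> space M \<Longrightarrow> norm (F i x) \<le> 2 * norm (D x)"
    using borel_measurable_implies_sequence_metric[OF D(1), of 0]
    unfolding space_H dist_norm diff_0_right by blast
  have F_M[measurable]: "F i \<in> borel_measurable M" for i
    by (rule measurable_H[OF borel_measurable_simple_function[OF F(1)]])
  note D_M[measurable] = square_integrable_borel[OF D(2)]
  have F2: "square_integrable M (F i)" for i
    unfolding square_integrable_def
  proof (intro conjI F_M)
    show "integrable M (\<lambda>x. (norm (F i x))\<^sup>2)"
    proof (rule Bochner_Integration.integrable_bound)
      show "integrable M (\<lambda>x. 4 * (norm (D x))\<^sup>2)" using square_integrable_norm2[OF D(2)] by simp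
      show "AE x in M. norm ((norm (F i x))\<^sup>2) \<le> norm (4 * (norm (D x))\<^sup>2)"
      proof (rule AE_I2)
        fix x assume "x \<in> space M"
        from power_mono[OF F(3)[OF this, of i] norm_ge_zero, of 2]
        show "norm ((norm (F i x))\<^sup>2) \<le> norm (4 * (norm (D x))\<^sup>2)"
          by (simp add: power_mult_distrib)
      qed
    qed measurable
  qed
  have "(\<lambda>i. \<integral>x. (norm (D x - F i x))\<^sup>2 \<partial>M) \<longlonglongrightarrow> (\<integral>x. 0 \<partial>M)"
  \<comment> \<open>The constant is the square of 3: the norm of \<open>D\<close> plus at most twice
    that norm.\<close>
  proof (rule integral_dominated_convergence[where w = "\<lambda>x. 9 * (norm (D x))\<^sup>2"])
    show "AE x in M. (\<lambda>i. (norm (D x - F i x))\<^sup>2) \<longlonglongrightarrow> 0"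
    proof (rule AE_I2)
      fix x assume "x \<in> space M"
      from F(2)[OF this] have "(\<lambda>i. (norm (D x - F i x))\<^sup>2) \<longlonglongrightarrow> (norm (D x - D x))\<^sup>2"
        by (intro tendsto_intros)
      then show "(\<lambda>i. (norm (D x - F i x))\<^sup>2) \<longlonglongrightarrow> 0" by simp
    qed
    show "AE x in M. norm ((norm (D x - F i x))\<^sup>2) \<le> 9 * (norm (D x))\<^sup>2" for i
    proof (rule AE_I2)
      fix x assume "x \<in> space M"
      have "norm (D x - F i x) \<le> 3 * norm (D x)"
        using norm_triangle_ineq4[of "D x" "F i x"] F(3)[OF \<open>x \<in> space M\<close>, of i] by linarith
      from power_mono[OF this, of 2] show "norm ((norm (D x - F i x))\<^sup>2) \<le> 9 * (norm (D x))\<^sup>2"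
        by (simp add: power_mult_distrib)
    qed
  qed (use square_integrable_norm2[OF D(2)] in simp_all)
  then have "(\<lambda>i. L2_norm M (\<lambda>x. D x - F i x)) \<longlonglongrightarrow> sqrt 0"
    unfolding L2_norm_def by (intro tendsto_real_sqrt) simp
  then have "eventually (\<lambda>i. L2_norm M (\<lambda>x. D x - F i x) < e) sequentially"
    using e by (intro order_tendstoD(2)) auto
  then obtain i where "L2_norm M (\<lambda>x. D x - F i x) < e"
    using eventually_happens'[OF sequentially_bot] by blast
  then show thesis by (rule that[OF F(1) F2])
qed

text \<open>A bounded sequence converges weakly once it does so against a set with dense span; here
  these are the coordinate vectors times indicators of events in \<open>H\<close>.\<close>

lemma weak_convergence_from_events:
  fixes R :: "nat \<Rightarrow> 'a \<Rightarrow> real ^ 'm"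
  assumes R: "\<And>n. square_integrable M (R n)" and bound: "\<And>n. L2_norm M (R n) \<le> K"
    and events_0: "\<And>B i. B \<in> sets H \<Longrightarrow> (\<lambda>n. \<integral>x. indicator B x * R n x $ i \<partial>M) \<longlonglongrightarrow> 0"
    and D: "D \<in> borel_measurable H" "square_integrable M D"
  shows "(\<lambda>n. \<integral>x. R n x \<bullet> D x \<partial>M) \<longlonglongrightarrow> 0"
proof (rule LIMSEQ_I)
  fix e :: real assume e: "e > 0"
  have "K \<ge> 0" using bound[of 0] L2_norm_nonneg[of M "R 0"] by linarith
  \<comment> \<open>\<open>K + 1\<close> in place of \<open>K\<close> avoids a zero denominator and
    still absorbs the norm of \<open>R n\<close>.\<close>
  obtain s where s: "simple_function H s" "square_integrable M s"
      "L2_norm M (\<lambda>x. D x - s x) < e / (2 * (K + 1))"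
    using simple_L2_approximation[OF D, of "e / (2 * (K + 1))"] e \<open>K \<ge> 0\<close> by auto
  define lev where "lev y = {x \<in> space M. s x = y}" for y
  have fin: "finite (s ` space M)" using simple_functionD(1)[OF s(1)] by (simp add: space_H)
  have lev_H: "lev y \<in> sets H" for y
  proof -
    have "s -` {y} \<inter> space H \<in> sets H" by (rule simple_functionD(2)[OF s(1)])
    moreover have "s -` {y} \<inter> space H = lev y" by (auto simp: lev_def space_H)
    ultimately show ?thesis by simp
  qed
  have int: "integrable M (\<lambda>x. indicator (lev y) x * R n x $ i)" for y n i
    using integrable_mult_indicator[OF sets_H[OF lev_H] square_integrable_integrable_nth[OF R]] by simp
  \<comment> \<open>The simple function is split over its finitely many values and their
    coordinates, leaving integrals over single events.\<close>
  have "(\<integral>x. R n x \<bullet> s x \<partial>M) =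
      (\<Sum>y\<in>s ` space M. \<Sum>i\<in>UNIV. y $ i * (\<integral>x. indicator (lev y) x * R n x $ i \<partial>M))" for n
  proof -
    have "(\<integral>x. R n x \<bullet> s x \<partial>M) =
      (\<integral>x. (\<Sum>y\<in>s ` space M. \<Sum>i\<in>UNIV. y $ i * (indicator (lev y) x * R n x $ i)) \<partial>M)"
    proof (rule Bochner_Integration.integral_cong[OF refl])
      fix x assume x: "x \<in> space M"
      have "(\<Sum>y\<in>s ` space M. \<Sum>i\<in>UNIV. y $ i * (indicator (lev y) x * R n x $ i)) =
          (\<Sum>y\<in>s ` space M. if y = s x then \<Sum>i\<in>UNIV. s x $ i * R n x $ i else 0)"
        using x by (intro sum.cong refl) (auto simp: lev_def)
      also have "\<dots> = R n x \<bullet> s x"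
        using x fin by (simp add: sum.delta inner_vec_def mult.commute)
      finally show "R n x \<bullet> s x = (\<Sum>y\<in>s ` space M. \<Sum>i\<in>UNIV. y $ i * (indicator (lev y) x * R n x $ i))" ..
    qed
    also have "\<dots> = (\<Sum>y\<in>s ` space M. \<Sum>i\<in>UNIV. y $ i * (\<integral>x. indicator (lev y) x * R n x $ i \<partial>M))"
      using int by (simp add: Bochner_Integration.integral_sum)
    finally show ?thesis .
  qed
  moreover have "(\<lambda>n. \<Sum>y\<in>s ` space M. \<Sum>i\<in>UNIV. y $ i * (\<integral>x. indicator (lev y) x * R n x $ i \<partial>M)) \<longlonglongrightarrow> 0"
    by (intro tendsto_null_sum tendsto_mult_right_zero events_0 lev_H)
  ultimately have "(\<lambda>n. \<integral>x. R n x \<bullet> s x \<partial>M) \<longlonglongrightarrow> 0" by simp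
  from LIMSEQ_D[OF this, of "e / 2"] e obtain n0 where
    n0: "\<And>n. n \<ge> n0 \<Longrightarrow> \<bar>\<integral>x. R n x \<bullet> s x \<partial>M\<bar> < e / 2" by auto
  have "\<bar>\<integral>x. R n x \<bullet> D x \<partial>M\<bar> < e" if "n \<ge> n0" for n
  proof -
    note Ds = square_integrable_diff[OF D(2) s(2)]
    have "(\<integral>x. R n x \<bullet> D x \<partial>M) = (\<integral>x. R n x \<bullet> s x + R n x \<bullet> (D x - s x) \<partial>M)"
      by (simp add: inner_diff_right)
    also have "\<dots> = (\<integral>x. R n x \<bullet> s x \<partial>M) + (\<integral>x. R n x \<bullet> (D x - s x) \<partial>M)"
      by (intro Bochner_Integration.integral_add square_integrable_inner R s Ds)
    finally have eq: "(\<integral>x. R n x \<bullet> D x \<partial>M) = (\<integral>x. R n x \<bullet> s x \<partial>M) + (\<integral>x. R n x \<bullet> (D x - s x) \<partial>M)" .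
    have "\<bar>\<integral>x. R n x \<bullet> (D x - s x) \<partial>M\<bar> \<le> L2_norm M (R n) * L2_norm M (\<lambda>x. D x - s x)"
      by (rule L2_Cauchy_Schwarz[OF R Ds])
    also have "\<dots> \<le> (K + 1) * (e / (2 * (K + 1)))"
      using bound[of n] s(3) \<open>K \<ge> 0\<close> by (intro mult_mono) auto
    also have "\<dots> = e / 2" using \<open>K \<ge> 0\<close> by (simp add: field_simps)
    finally show ?thesis using eq n0[OF that] by linarith
  qed
  then show "\<exists>no. \<forall>n\<ge>no. norm ((\<integral>x. R n x \<bullet> D x \<partial>M) - 0) < e" by auto
qed

section \<open>The dictionary of normalised events\<close>

text \<open>If \<open>P E\<close> is 0 or 1, the division by 0 makes this the zero function.\<close>

definition event_direction :: "'a set \<Rightarrow> 'm \<Rightarrow> 'a \<Rightarrow> real ^ 'm" where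
  "event_direction E i = (\<lambda>x.
     ((indicator E x - prob E) / sqrt (prob E * (1 - prob E))) *\<^sub>R axis i 1)"

lemma event_direction_measurable_H:
  assumes "E \<in> sets H"
  shows "event_direction E i \<in> borel_measurable H"
proof -
  note [measurable] = assms
  show ?thesis unfolding event_direction_def by measurable
qed

lemma square_integrable_event_direction:
  assumes "E \<in> sets H"
  shows "square_integrable M (event_direction E i)"
  unfolding square_integrable_def
proof
  show meas: "event_direction E i \<in> borel_measurable M"
    by (rule measurable_H[OF event_direction_measurable_H[OF assms]])
  show "integrable M (\<lambda>x. (norm (event_direction E i x))\<^sup>2)"
  proof (rule integrable_const_bound)
    show "AE x in M. norm ((norm (event_direction E i x))\<^sup>2) \<le> (1 / sqrt (prob E * (1 - prob E)))\<^sup>2"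
    proof (rule AE_I2)
      fix x
      have "\<bar>indicator E x - prob E\<bar> \<le> 1"
        using measure_nonneg[of M E] prob_le_1[of E] by (auto simp: indicator_def)
      then have "\<bar>(indicator E x - prob E) / sqrt (prob E * (1 - prob E))\<bar> \<le> 1 / sqrt (prob E * (1 - prob E))"
        by (simp add: abs_mult divide_right_mono)
      then have "norm (event_direction E i x) \<le> 1 / sqrt (prob E * (1 - prob E))"
        by (simp add: event_direction_def)
      from power_mono[OF this norm_ge_zero, of 2]
      show "norm ((norm (event_direction E i x))\<^sup>2) \<le> (1 / sqrt (prob E * (1 - prob E)))\<^sup>2"
        by simp
    qed
  qed (use meas in measurable)
qed

lemma event_direction_unit:
  assumes "E \<in> sets H"
  shows "(\<integral>x. (norm (event_direction E i x))\<^sup>2 \<partial>M) = 1 \<or> event_direction E i = (\<lambda>_. 0)"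
proof (cases "prob E * (1 - prob E) = 0")
  case False
  define p where "p = prob E"
  have "0 \<le> p" "p \<le> 1" by (auto simp: p_def)
  moreover have "p \<noteq> 0" "p \<noteq> 1" using False by (auto simp: p_def)
  ultimately have p: "p * (1 - p) > 0" by simp
  note [simp] = integrable_indicator_event[OF sets_H[OF assms]]
  \<comment> \<open>An indicator equals its own square, so the squared centred indicator is affine
    in the indicator.\<close>
  have "(\<integral>x. (norm (event_direction E i x))\<^sup>2 \<partial>M)
      = (\<integral>x. ((1 - 2 * p) * indicator E x + p\<^sup>2) / (p * (1 - p)) \<partial>M)"
    using p by (intro Bochner_Integration.integral_cong)
      (auto simp: event_direction_def p_def[symmetric] power_divide indicator_def power2_eq_square algebra_simps)
  also have "\<dots> = ((1 - 2 * p) * p + p\<^sup>2) / (p * (1 - p))"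
    using sets_H[OF assms] by (simp add: prob_space p_def)
  also have "(1 - 2 * p) * p + p\<^sup>2 = p * (1 - p)" by (simp add: algebra_simps power2_eq_square)
  also have "p * (1 - p) / (p * (1 - p)) = 1" by (rule divide_self) (use p in linarith)
  finally show ?thesis ..
next
  case True
  then have "event_direction E i = (\<lambda>_. 0)"
    unfolding event_direction_def by (simp only: real_sqrt_zero div_by_0 scaleR_zero_left)
  then show ?thesis ..
qed

text \<open>Independence factorises \<open>prob (E \<inter> A)\<close>, and centring cancels the
  product. This is the vanishing conditional expectation that later makes the \<open>Z n\<close>
  martingales.\<close>

lemma integral_indicator_event_direction:
  assumes E: "E \<in> indep_events_H" and A: "A \<in> sets G"
  shows "(\<integral>x. indicator A x * event_direction E i x $ k \<partial>M) = 0"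
proof -
  have EH: "E \<in> sets H" using E by (simp add: indep_events_H_def)
  note [simp] = sets_H[OF EH] sets_G[OF A]
  have EA: "E \<inter> A \<in> sets M" by (rule sets.Int[OF sets_H[OF EH] sets_G[OF A]])
  note [simp] = EA integrable_indicator_event[OF EA] integrable_indicator_event[OF sets_G[OF A]]
  define c where "c = axis i (1::real) $ k / sqrt (prob E * (1 - prob E))"
  have "event_direction E i x $ k = c * (indicator E x - prob E)" for x
    by (simp add: event_direction_def c_def)
  then have "(\<integral>x. indicator A x * event_direction E i x $ k \<partial>M)
      = (\<integral>x. c * indicator (E \<inter> A) x - c * prob E * indicator A x \<partial>M)"
    by (intro Bochner_Integration.integral_cong) (auto simp: indicator_def algebra_simps)
  also have "\<dots> = c * prob (E \<inter> A) - c * prob E * prob A"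
    by (subst Bochner_Integration.integral_diff) (auto simp del: Int_iff)
  finally show ?thesis using E A by (simp add: indep_events_H_def)
qed

text \<open>The variable depends only on the indicator of \<open>E\<close>, so its preimages are the
  empty set, \<open>E\<close>, its complement or the whole space; independence passes from
  \<open>E\<close> to its complement.\<close>

lemma indep_of_algebra_event_direction:
  fixes i :: "'m::finite"
  assumes E: "E \<in> indep_events_H"
  shows "indep_of_algebra M (\<lambda>x. c *\<^sub>R event_direction E i x) G"
proof (rule indep_of_algebraI)
  have EH: "E \<in> sets H" using E by (simp add: indep_events_H_def)
  have EM: "E \<in> sets M" by (rule sets_H[OF EH])
  show "(\<lambda>x. c *\<^sub>R event_direction E i x) \<in> borel_measurable M"
    using measurable_H[OF event_direction_measurable_H[OF EH]] by measurable
  fix B :: "(real ^ 'm) set" and A assume A: "A \<in> sets G"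
  define v where "v b = c *\<^sub>R (((b - prob E) / sqrt (prob E * (1 - prob E))) *\<^sub>R axis i (1::real))" for b
  have v: "c *\<^sub>R event_direction E i x = v (indicator E x)" for x
    by (simp add: v_def event_direction_def)
  have AM: "A \<in> sets M" by (rule sets_G[OF A])
  have ind: "prob (E \<inter> A) = prob E * prob A" using E A by (simp add: indep_events_H_def)
  have "space M \<inter> A = A" "space M \<inter> E = E" using sets.sets_into_space[OF AM] sets.sets_into_space[OF EM] by auto
  have ind': "prob ((space M - E) \<inter> A) = prob (space M - E) * prob A"
  proof -
    have "(space M - E) \<inter> A = A - E \<inter> A" using sets.sets_into_space[OF AM] by auto
    then have "prob ((space M - E) \<inter> A) = prob A - prob (E \<inter> A)"
      using EM AM by (simp only:) (rule finite_measure_Diff, auto)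
    then show ?thesis using EM by (simp add: prob_compl ind algebra_simps)
  qed
  have "(\<lambda>x. c *\<^sub>R event_direction E i x) -` B \<inter> space M =
      (if v 1 \<in> B then E else {}) \<union> (if v 0 \<in> B then space M - E else {})"
    using sets.sets_into_space[OF EM]
    unfolding v by (auto simp: indicator_def of_bool_def split: if_splits)
  then show "prob ((\<lambda>x. c *\<^sub>R event_direction E i x) -` B \<inter> space M \<inter> A)
      = prob ((\<lambda>x. c *\<^sub>R event_direction E i x) -` B \<inter> space M) * prob A"
    using ind ind' \<open>space M \<inter> A = A\<close> \<open>space M \<inter> E = E\<close> sets.sets_into_space[OF EM]
    by (auto simp: prob_space Un_absorb1)
qed

text \<open>The zero mean removes the centring constant, and dividing by a standard deviation of at
  most 1 only enlarges the integral. In the degenerate case \<open>E\<close> is null or full and the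
  integral over \<open>E\<close> is 0. Thus bounds against the dictionary yield bounds on
  events.\<close>

lemma integral_inner_event_direction:
  fixes R :: "'a \<Rightarrow> real ^ 'm"
  assumes R: "square_integrable M R" and E: "E \<in> sets H"
    and R0: "(\<integral>x. R x $ i \<partial>M) = 0"
  shows "\<bar>\<integral>x. indicator E x * R x $ i \<partial>M\<bar> \<le> \<bar>\<integral>x. R x \<bullet> event_direction E i x \<partial>M\<bar>"
proof -
  have EM: "E \<in> sets M" by (rule sets_H[OF E])
  have int: "integrable M (\<lambda>x. R x $ i)" by (rule square_integrable_integrable_nth[OF R])
  have intE: "integrable M (\<lambda>x. indicator E x * R x $ i)"
    using integrable_mult_indicator[OF EM int] by simp
  define \<sigma> where "\<sigma> = sqrt (prob E * (1 - prob E))"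
  have "prob E * (1 - prob E) \<le> 1 * 1" by (intro mult_mono) auto
  then have \<sigma>: "0 \<le> \<sigma>" "\<sigma> \<le> 1" by (auto simp: \<sigma>_def)
  show ?thesis
  proof (cases "\<sigma> = 0")
    case True
    then consider "prob E = 0" | "prob E = 1" by (auto simp: \<sigma>_def)
    then have "(\<integral>x. indicator E x * R x $ i \<partial>M) = 0"
    proof cases
      case 1
      then have "AE x in M. x \<notin> E" using EM by (simp add: prob_eq_0)
      then have "AE x in M. indicator E x * R x $ i = 0" by eventually_elim simp
      then show ?thesis by (rule integral_eq_zero_AE)
    next
      case 2
      then have "AE x in M. x \<in> E" using EM by (simp add: prob_eq_1)
      then have "AE x in M. indicator E x * R x $ i = R x $ i" by eventually_elim simp
      from integral_cong_AE[OF _ _ this] show ?thesis using int intE R0 by auto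
    qed
    then show ?thesis by simp
  next
    case False
    with \<sigma> have pos: "\<sigma> > 0" by simp
    have "(\<integral>x. R x \<bullet> event_direction E i x \<partial>M) =
        (\<integral>x. (indicator E x * R x $ i - prob E * R x $ i) / \<sigma> \<partial>M)"
    proof (rule Bochner_Integration.integral_cong[OF refl])
      fix x
      have "R x \<bullet> event_direction E i x = (indicator E x - prob E) / \<sigma> * R x $ i"
        by (simp add: event_direction_def \<sigma>_def inner_axis)
      then show "R x \<bullet> event_direction E i x = (indicator E x * R x $ i - prob E * R x $ i) / \<sigma>"
        by (simp add: left_diff_distrib)
    qed
    also have "\<dots> = (\<integral>x. indicator E x * R x $ i \<partial>M) / \<sigma>"
      using int intE R0 by simp
    finally have "\<sigma> * \<bar>\<integral>x. R x \<bullet> event_direction E i x \<partial>M\<bar> = \<bar>\<integral>x. indicator E x * R x $ i \<partial>M\<bar>"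
      using pos by (simp add: abs_divide)
    then show ?thesis using \<sigma> mult_right_mono[of \<sigma> 1 "\<bar>\<integral>x. R x \<bullet> event_direction E i x \<partial>M\<bar>"] by simp
  qed
qed

text \<open>The greedy expansion over the event directions. Its hypothesis on weak convergence is
  checked by passing from directions to independent events, then to all events of \<open>H\<close>,
  and finally to \<open>D\<close>.\<close>

lemma one_step_decomposition:
  fixes D :: "'a \<Rightarrow> real ^ 'm"
  assumes D: "D \<in> borel_measurable H" "square_integrable M D"
    and D0: "\<And>A i. A \<in> sets G \<Longrightarrow> (\<integral>x. indicator A x * D x $ i \<partial>M) = 0"
  shows "\<exists>Y :: nat \<Rightarrow> 'a \<Rightarrow> real ^ 'm.
    (\<forall>n. Y n \<in> borel_measurable H \<and> square_integrable M (Y n) \<and> indep_of_algebra M (Y n) G \<and>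
       (\<forall>A\<in>sets G. \<forall>i. (\<integral>x. indicator A x * Y n x $ i \<partial>M) = 0)) \<and>
    (\<lambda>N. L2_norm M (\<lambda>x. D x - (\<Sum>n<N. Y n x))) \<longlonglongrightarrow> 0 \<and>
    (\<lambda>n. (L2_norm M (Y n))\<^sup>2) sums (L2_norm M D)\<^sup>2"
proof -
  define \<D> where "\<D> = {event_direction E i | E (i::'m). E \<in> indep_events_H}"
  have dir: "event_direction E i \<in> \<D>" if "E \<in> indep_events_H" for E i
    using that by (auto simp: \<D>_def)
  \<comment> \<open>The empty event, whose direction is the zero function, guarantees that the
    dictionary is nonempty.\<close>
  have emp: "{} \<in> indep_events_H" by (simp add: indep_events_H_def)
  have \<D>_H: "g \<in> borel_measurable H" and \<D>_sq: "square_integrable M g"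
    and \<D>_unit: "(\<integral>x. (norm (g x))\<^sup>2 \<partial>M) = 1 \<or> g = (\<lambda>_. 0)"
    and \<D>_G: "\<And>A i. A \<in> sets G \<Longrightarrow> (\<integral>x. indicator A x * g x $ i \<partial>M) = 0"
    and \<D>_indep: "\<And>c. indep_of_algebra M (\<lambda>x. c *\<^sub>R g x) G"
    if "g \<in> \<D>" for g
  proof -
    from that obtain E i where g: "g = event_direction E i" and E: "E \<in> indep_events_H"
      by (auto simp: \<D>_def)
    then have EH: "E \<in> sets H" by (simp add: indep_events_H_def)
    show "g \<in> borel_measurable H" unfolding g by (rule event_direction_measurable_H[OF EH])
    show "square_integrable M g" unfolding g by (rule square_integrable_event_direction[OF EH])
    show "(\<integral>x. (norm (g x))\<^sup>2 \<partial>M) = 1 \<or> g = (\<lambda>_. 0)" unfolding g by (rule event_direction_unit[OF EH])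
    show "\<And>A i. A \<in> sets G \<Longrightarrow> (\<integral>x. indicator A x * g x $ i \<partial>M) = 0"
      unfolding g by (rule integral_indicator_event_direction[OF E])
    show "\<And>c. indep_of_algebra M (\<lambda>x. c *\<^sub>R g x) G"
      unfolding g by (rule indep_of_algebra_event_direction[OF E])
  qed
  have "\<exists>h c. (\<forall>j. h j \<in> \<D>) \<and>
    (\<lambda>n. L2_norm M (\<lambda>x. D x - (\<Sum>j<n. c j *\<^sub>R h j x))) \<longlonglongrightarrow> 0 \<and>
    (\<lambda>j. (L2_norm M (\<lambda>x. c j *\<^sub>R h j x))\<^sup>2) sums (L2_norm M D)\<^sup>2"
  proof (rule weak_greedy_expansion[OF D(2) \<D>_sq \<D>_unit])
    show "\<D> \<noteq> {}" using dir[OF emp] by auto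
    fix h :: "nat \<Rightarrow> 'a \<Rightarrow> real ^ 'm" and c \<delta> :: "nat \<Rightarrow> real"
    assume h: "\<And>j. h j \<in> \<D>" and \<delta>: "\<delta> \<longlonglongrightarrow> 0"
      and bound: "\<And>n. L2_norm M (\<lambda>x. D x - (\<Sum>j<n. c j *\<^sub>R h j x)) \<le> L2_norm M D"
      and small: "\<And>n g. g \<in> \<D> \<Longrightarrow> \<bar>\<integral>x. (D x - (\<Sum>j<n. c j *\<^sub>R h j x)) \<bullet> g x \<partial>M\<bar> \<le> \<delta> n"
    define R where "R n = (\<lambda>x. D x - (\<Sum>j<n. c j *\<^sub>R h j x))" for n
    have R: "square_integrable M (R n)" for n
      unfolding R_def
      by (intro square_integrable_diff square_integrable_sum square_integrable_scaleR D(2) \<D>_sq[OF h])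
    have R_nth: "integrable M (\<lambda>x. R n x $ i)" for n i
      by (rule square_integrable_integrable_nth[OF R])
    \<comment> \<open>Orthogonality to \<open>G\<close> survives every greedy step, since
      \<open>D\<close> and all dictionary elements have it.\<close>
    have R_G: "(\<integral>x. indicator A x * R n x $ i \<partial>M) = 0" if A: "A \<in> sets G" for A n i
    proof -
      have int: "integrable M (\<lambda>x. indicator A x * f x $ i)" if "square_integrable M f" for f :: "'a \<Rightarrow> real ^ 'm"
        using integrable_mult_indicator[OF sets_G[OF A] square_integrable_integrable_nth[OF that]] by simp
      have "(\<integral>x. indicator A x * R n x $ i \<partial>M) =
        (\<integral>x. indicator A x * D x $ i - (\<Sum>j<n. c j * (indicator A x * h j x $ i)) \<partial>M)"
        by (simp add: R_def right_diff_distrib sum_distrib_left mult.left_commute)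
      also have "\<dots> = (\<integral>x. indicator A x * D x $ i \<partial>M) - (\<Sum>j<n. c j * (\<integral>x. indicator A x * h j x $ i \<partial>M))"
        using int[OF D(2)] int[OF \<D>_sq[OF h]]
        by (subst Bochner_Integration.integral_diff) (auto simp: Bochner_Integration.integral_sum)
      also have "\<dots> = 0" using D0[OF A] \<D>_G[OF h A] by simp
      finally show ?thesis .
    qed
    have R_mean: "(\<integral>x. R n x $ i \<partial>M) = 0" for n i
    proof -
      have "(\<integral>x. R n x $ i \<partial>M) = (\<integral>x. indicator (space M) x * R n x $ i \<partial>M)"
        by (intro Bochner_Integration.integral_cong) auto
      then show ?thesis using R_G[OF sets.top] by (simp add: space_G)
    qed
    have "(\<lambda>n. \<integral>x. R n x \<bullet> D x \<partial>M) \<longlonglongrightarrow> 0"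
    proof (rule weak_convergence_from_events[OF R _ _ D])
      show "L2_norm M (R n) \<le> L2_norm M D" for n using bound by (simp add: R_def)
      fix B i assume B: "B \<in> sets H"
      show "(\<lambda>n. \<integral>x. indicator B x * R n x $ i \<partial>M) \<longlonglongrightarrow> 0"
      proof (rule integral_event_tendsto_0[OF _ _ _ R_G _ \<delta> B])
        show "(\<lambda>x. R n x $ i) \<in> borel_measurable M" for n using R_nth by auto
        show "integrable M (\<lambda>x. (R n x $ i)\<^sup>2)" for n by (rule square_integrable_nth[OF R])
        show "(\<integral>x. (R n x $ i)\<^sup>2 \<partial>M) \<le> (L2_norm M D)\<^sup>2" for n
        proof -
          have "(\<integral>x. (R n x $ i)\<^sup>2 \<partial>M) \<le> (\<integral>x. (norm (R n x))\<^sup>2 \<partial>M)"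
            by (intro integral_mono square_integrable_nth[OF R] square_integrable_norm2[OF R])
               (use component_le_norm_cart in \<open>auto simp: abs_le_square_iff[symmetric]\<close>)
          also have "\<dots> = (L2_norm M (R n))\<^sup>2" by (simp add: L2_norm_power2)
          also have "\<dots> \<le> (L2_norm M D)\<^sup>2" using bound by (intro power_mono) (simp_all add: R_def)
          finally show ?thesis .
        qed
        fix n E assume E: "E \<in> indep_events_H"
        then have "E \<in> sets H" by (simp add: indep_events_H_def)
        from integral_inner_event_direction[OF R this R_mean]
        show "\<bar>\<integral>x. indicator E x * R n x $ i \<partial>M\<bar> \<le> \<delta> n"
          using small[OF dir[OF E, of i], of n] unfolding R_def by (rule order_trans)
      qed
    qed
    then show "(\<lambda>n. \<integral>x. (D x - (\<Sum>j<n. c j *\<^sub>R h j x)) \<bullet> D x \<partial>M) \<longlonglongrightarrow> 0" by (simp add: R_def)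
  qed
  then obtain h c where h: "\<And>j. h j \<in> \<D>"
    and lim: "(\<lambda>n. L2_norm M (\<lambda>x. D x - (\<Sum>j<n. c j *\<^sub>R h j x))) \<longlonglongrightarrow> 0"
    and sums: "(\<lambda>j. (L2_norm M (\<lambda>x. c j *\<^sub>R h j x))\<^sup>2) sums (L2_norm M D)\<^sup>2"
    by blast
  have "(\<lambda>x. c n *\<^sub>R h n x) \<in> borel_measurable H" for n
    using \<D>_H[OF h] by measurable
  moreover have "(\<integral>x. indicator A x * (c n *\<^sub>R h n x) $ i \<partial>M) = 0" if "A \<in> sets G" for A n i
  proof -
    have "(\<integral>x. indicator A x * (c n *\<^sub>R h n x) $ i \<partial>M) = (\<integral>x. c n * (indicator A x * h n x $ i) \<partial>M)"
      by (simp add: mult.left_commute)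
    then show ?thesis using \<D>_G[OF h that] by simp
  qed
  ultimately show ?thesis
    using lim sums \<D>_indep[OF h] square_integrable_scaleR[OF \<D>_sq[OF h]]
    by (intro exI[of _ "\<lambda>n x. c n *\<^sub>R h n x"]) auto
qed

end

subsection \<open>Martingale differences\<close>

text \<open>Coordinatewise, the \<open>G\<close>-measurable factor is pulled out of the conditional
  expectation, which is 0. This gives the orthogonality of martingale increments to the
  past.\<close>

lemma (in prob_subalgebra) integral_inner_G_0:
  fixes S V :: "'a \<Rightarrow> real ^ 'm"
  assumes S: "S \<in> borel_measurable G" "square_integrable M S" and V: "square_integrable M V"
    and V0: "\<And>A i. A \<in> sets G \<Longrightarrow> (\<integral>x. indicator A x * V x $ i \<partial>M) = 0"
  shows "(\<integral>x. S x \<bullet> V x \<partial>M) = 0"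
proof -
  have V_int: "integrable M (\<lambda>x. V x $ i)" for i by (rule square_integrable_integrable_nth[OF V])
  have ce: "AE x in M. real_cond_exp M G (\<lambda>x. V x $ i) x = 0" for i
    by (rule real_cond_exp_charact) (use V_int V0 in \<open>auto simp: set_lebesgue_integral_def\<close>)
  have int: "integrable M (\<lambda>x. S x $ i * V x $ i)" for i
  proof (rule Bochner_Integration.integrable_bound)
    show "integrable M (\<lambda>x. (S x $ i)\<^sup>2 + (V x $ i)\<^sup>2)"
      by (intro Bochner_Integration.integrable_add square_integrable_nth S V)
    show "(\<lambda>x. S x $ i * V x $ i) \<in> borel_measurable M"
      by (intro borel_measurable_times borel_measurable_nth_compose square_integrable_borel S V)
    show "AE x in M. norm (S x $ i * V x $ i) \<le> norm ((S x $ i)\<^sup>2 + (V x $ i)\<^sup>2)"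
    proof (rule AE_I2)
      fix x
      show "norm (S x $ i * V x $ i) \<le> norm ((S x $ i)\<^sup>2 + (V x $ i)\<^sup>2)"
      proof -
        have "0 \<le> \<bar>S x $ i\<bar> * \<bar>V x $ i\<bar>" by simp
        moreover have "2 * (\<bar>S x $ i\<bar> * \<bar>V x $ i\<bar>) \<le> (S x $ i)\<^sup>2 + (V x $ i)\<^sup>2"
          using sum_squares_bound[of "\<bar>S x $ i\<bar>" "\<bar>V x $ i\<bar>"] by (simp add: mult.assoc)
        ultimately have "\<bar>S x $ i\<bar> * \<bar>V x $ i\<bar> \<le> (S x $ i)\<^sup>2 + (V x $ i)\<^sup>2" by linarith
        then show ?thesis by (simp add: abs_mult)
      qed
    qed
  qed
  have "(\<integral>x. S x $ i * V x $ i \<partial>M) = 0" for i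
  proof -
    have "(\<integral>x. S x $ i * V x $ i \<partial>M) = (\<integral>x. S x $ i * real_cond_exp M G (\<lambda>x. V x $ i) x \<partial>M)"
      using int V_int borel_measurable_nth_compose[OF S(1)] by (intro real_cond_exp_intg(2)[symmetric]) auto
    also have "\<dots> = 0"
    proof (rule integral_eq_zero_AE)
      show "AE x in M. S x $ i * real_cond_exp M G (\<lambda>x. V x $ i) x = 0"
        using ce[of i] by eventually_elim simp
    qed
    finally show ?thesis .
  qed
  then show ?thesis using int by (simp add: inner_vec_def Bochner_Integration.integral_sum)
qed

lemma filtered_prob_subalgebra:
  assumes "filtered_prob_space M F"
  shows "prob_subalgebra M (F k)"
  using assms by (simp add: filtered_prob_space_def prob_subalgebra_def prob_subalgebra_axioms_def)

lemma filtered_subalgebra_mono: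
  assumes "filtered_prob_space M F" "j \<le> k"
  shows "subalgebra (F k) (F j)"
  using assms unfolding filtered_prob_space_def filtration_def subalgebra_def by blast

text \<open>The zero conditional mean is phrased through integrals over past events. It is
  instantiated for the increments of \<open>X\<close>, of each \<open>Z n\<close>, and of the
  remainders after \<open>N\<close> terms.\<close>

locale martingale_differences =
  fixes M :: "'a measure" and F :: "nat \<Rightarrow> 'a measure" and V :: "nat \<Rightarrow> 'a \<Rightarrow> real ^ 'm"
  assumes filtered: "filtered_prob_space M F"
    and V_F: "\<And>j. j \<ge> 1 \<Longrightarrow> V j \<in> borel_measurable (F j)"
    and V_sq: "\<And>j. j \<ge> 1 \<Longrightarrow> square_integrable M (V j)"
    and V_0: "\<And>j A i. j \<ge> 1 \<Longrightarrow> A \<in> sets (F (j - 1)) \<Longrightarrow> (\<integral>x. indicator A x * V j x $ i \<partial>M) = 0"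
begin

lemma partial_sum_F: "(\<lambda>x. \<Sum>j\<in>{1..k}. V j x) \<in> borel_measurable (F k)"
  by (intro borel_measurable_sum measurable_from_subalg[OF filtered_subalgebra_mono[OF filtered] V_F]) auto

lemma partial_sum_sq: "square_integrable M (\<lambda>x. \<Sum>j\<in>{1..k}. V j x)"
  by (intro square_integrable_sum V_sq) simp

text \<open>Pythagoras: each new difference is orthogonal to the partial sum before it.\<close>

lemma partial_sum_energy:
  "(L2_norm M (\<lambda>x. \<Sum>j\<in>{1..k}. V j x))\<^sup>2 = (\<Sum>j\<in>{1..k}. (L2_norm M (V j))\<^sup>2)"
proof (induction k)
  case (Suc k)
  have Suc_k: "1 \<le> Suc k" by simp
  interpret prob_subalgebra M "F k" by (rule filtered_prob_subalgebra[OF filtered])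
  have "(L2_norm M (\<lambda>x. \<Sum>j\<in>{1..Suc k}. V j x))\<^sup>2 =
      (\<integral>x. (norm ((\<Sum>j\<in>{1..k}. V j x) + V (Suc k) x))\<^sup>2 \<partial>M)"
    by (simp add: L2_norm_power2 add.commute)
  also have "\<dots> = (L2_norm M (\<lambda>x. \<Sum>j\<in>{1..k}. V j x))\<^sup>2 + (L2_norm M (V (Suc k)))\<^sup>2"
    unfolding integral_norm2_add[OF partial_sum_sq V_sq[OF Suc_k]]
    using V_0[OF Suc_k]
    by (subst integral_inner_G_0[OF partial_sum_F partial_sum_sq V_sq[OF Suc_k]]) (auto simp: L2_norm_power2)
  finally show ?case using Suc.IH by simp
qed (simp add: L2_norm_def)

lemma partial_sum_martingale: "L2_martingale M F (\<lambda>k x. \<Sum>j\<in>{1..k}. V j x)"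
  unfolding L2_martingale_def
proof (intro conjI allI impI)
  fix k i assume k: "(1::nat) \<le> k"
  interpret prob_subalgebra M "F (k - 1)" by (rule filtered_prob_subalgebra[OF filtered])
  obtain l where l: "k = Suc l" using k by (cases k) auto
  note int = square_integrable_integrable_nth[OF partial_sum_sq] square_integrable_integrable_nth[OF V_sq]
  show "AE x in M. real_cond_exp M (F (k - 1)) (\<lambda>x. (\<Sum>j\<in>{1..k}. V j x) $ i) x = (\<Sum>j\<in>{1..k - 1}. V j x) $ i"
  proof (rule real_cond_exp_charact)
    fix A assume A: "A \<in> sets (F (k - 1))"
    have intA: "integrable M (\<lambda>x. indicator A x * f x)" if "integrable M f" for f :: "'a \<Rightarrow> real"
      using integrable_mult_indicator[OF sets_G[OF A] that] by simp
    have "(\<integral>x. indicator A x * (\<Sum>j\<in>{1..k}. V j x) $ i \<partial>M) =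
      (\<integral>x. indicator A x * (\<Sum>j\<in>{1..l}. V j x) $ i + indicator A x * V k x $ i \<partial>M)"
      by (simp add: l algebra_simps)
    also have "\<dots> = (\<integral>x. indicator A x * (\<Sum>j\<in>{1..l}. V j x) $ i \<partial>M) + (\<integral>x. indicator A x * V k x $ i \<partial>M)"
      by (intro Bochner_Integration.integral_add intA int k)
    also have "(\<integral>x. indicator A x * V k x $ i \<partial>M) = 0" by (rule V_0[OF k A])
    finally show "(LINT x:A|M. (\<Sum>j\<in>{1..k}. V j x) $ i) = (LINT x:A|M. (\<Sum>j\<in>{1..k - 1}. V j x) $ i)"
      by (simp add: set_lebesgue_integral_def l)
  qed (use int borel_measurable_nth_compose[OF partial_sum_F] in auto)
qed (rule partial_sum_F partial_sum_sq)+

end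

text \<open>Induction over the finite index set, adding the largest index last: the events of all
  smaller indices lie in the past of the new variable, which is independent of it.\<close>

lemma indep_vars_adapted:
  fixes V :: "nat \<Rightarrow> 'a \<Rightarrow> 'b::topological_space"
  assumes filt: "filtered_prob_space M F"
    and V: "\<And>j. j \<ge> 1 \<Longrightarrow> V j \<in> borel_measurable (F j)"
    and ind: "\<And>j. j \<ge> 1 \<Longrightarrow> indep_of_algebra M (V j) (F (j - 1))"
  shows "prob_space.indep_vars M (\<lambda>_. borel) V {1..}"
proof -
  interpret prob_space M using filt by (simp add: filtered_prob_space_def)
  have V_M: "V j \<in> borel_measurable M" if "j \<ge> 1" for j
    using ind[OF that] by (simp add: indep_of_algebra_def)
  \<comment> \<open>The intersection with \<open>space M\<close> gives the empty index set its
    proper meaning, as an empty intersection is the whole type.\<close>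
  have main: "finite J \<Longrightarrow> J \<subseteq> {1..} \<Longrightarrow> (\<And>j. j \<in> J \<Longrightarrow> B j \<in> sets borel) \<Longrightarrow>
      prob (space M \<inter> (\<Inter>j\<in>J. V j -` B j \<inter> space M)) = (\<Prod>j\<in>J. prob (V j -` B j \<inter> space M))"
    for J :: "nat set" and B :: "nat \<Rightarrow> 'b set"
  proof (induction J rule: finite_linorder_max_induct)
    case empty
    then show ?case by (simp add: prob_space)
  next
    case (insert k J)
    interpret prob_subalgebra M "F (k - 1)" by (rule filtered_prob_subalgebra[OF filt])
    let ?I = "space M \<inter> (\<Inter>j\<in>J. V j -` B j \<inter> space M)"
    have k: "k \<ge> 1" using insert.prems by auto
    have past: "V j -` B j \<inter> space M \<in> sets (F (k - 1))" if j: "j \<in> J" for j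
    proof -
      have "1 \<le> j" "j \<le> k - 1" using j insert.prems insert.hyps by force+
      then have "V j \<in> borel_measurable (F (k - 1))"
        by (intro measurable_from_subalg[OF filtered_subalgebra_mono[OF filt] V])
      from measurable_sets[OF this, of "B j"] insert.prems(2) j show ?thesis unfolding space_G by blast
    qed
    have top: "space M \<in> sets (F (k - 1))"
      using sets.top[of "F (k - 1)"] unfolding space_G .
    have I: "?I \<in> sets (F (k - 1))"
    proof (cases "J = {}")
      case False
      show ?thesis by (intro sets.Int top sets.finite_INT insert.hyps(1) False past)
    qed (use top in simp)
    have "prob (space M \<inter> (\<Inter>j\<in>insert k J. V j -` B j \<inter> space M)) = prob ((V k -` B k \<inter> space M) \<inter> ?I)"
      by (intro arg_cong[where f = prob]) auto
    also have "\<dots> = prob (V k -` B k \<inter> space M) * prob ?I"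
      using insert.prems by (intro indep_of_algebraD[OF ind[OF k] _ I]) auto
    also have "prob ?I = (\<Prod>j\<in>J. prob (V j -` B j \<inter> space M))"
      using insert.prems by (intro insert.IH) auto
    finally show ?case using insert.hyps by (subst prod.insert) auto
  qed
  show ?thesis
    unfolding indep_vars_def2
  proof (intro conjI ballI indep_setsI)
    fix A J assume J: "J \<noteq> {}" "J \<subseteq> {1::nat..}" "finite J"
      and A: "\<forall>j\<in>J. A j \<in> {V j -` B \<inter> space M |B. B \<in> sets borel}"
    then have "\<forall>j\<in>J. \<exists>B. A j = V j -` B \<inter> space M \<and> B \<in> sets borel" by blast
    from bchoice[OF this] obtain B
      where B: "\<forall>j\<in>J. A j = V j -` B j \<inter> space M \<and> B j \<in> sets borel" by blast
    have "(\<Inter>j\<in>J. A j) = space M \<inter> (\<Inter>j\<in>J. V j -` B j \<inter> space M)"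
      using B J(1) by auto
    then show "prob (\<Inter>j\<in>J. A j) = (\<Prod>j\<in>J. prob (A j))"
      using main[OF J(3,2), of B] B by simp
  qed (auto intro: V_M measurable_sets[OF V_M])
qed

section \<open>Assembly of the martingales from the expanded increments\<close>

theorem theorem1p1:
  fixes M :: "'a measure" and F :: "nat \<Rightarrow> 'a measure"
    and U :: "nat \<Rightarrow> 'a \<Rightarrow> real"
    and X :: "nat \<Rightarrow> 'a \<Rightarrow> real ^ 'm"
  assumes "filtered_prob_space M F"
    and "sets (F 0) = {{}, space M}"
    and "\<And>k. k \<ge> 1 \<Longrightarrow> U k \<in> borel_measurable (F k)"
    and "\<And>k. k \<ge> 1 \<Longrightarrow> distr M borel (U k) = uniform_measure lborel {0..1}"
    and "\<And>k. k \<ge> 1 \<Longrightarrow> indep_of_algebra M (U k) (F (k - 1))"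
    and "L2_martingale M F X"
    and "\<And>\<omega>. \<omega> \<in> space M \<Longrightarrow> X 0 \<omega> = 0"
  shows "\<exists>Z :: nat \<Rightarrow> nat \<Rightarrow> 'a \<Rightarrow> real ^ 'm.
     (\<forall>n\<ge>1. L2_martingale M F (Z n)) \<and>
     (\<forall>n\<ge>1. \<forall>\<omega>\<in>space M. Z n 0 \<omega> = 0) \<and>
     (\<forall>n\<ge>1. \<forall>k\<ge>1.
        indep_of_algebra M (\<lambda>\<omega>. Z n k \<omega> - Z n (k - 1) \<omega>) (F (k - 1))) \<and>
     (\<forall>k. L2_sums M (\<lambda>n. Z n k) (X k)) \<and>
     (\<forall>k\<ge>1. (\<lambda>n. (L2_norm M (Z (Suc n) k))\<^sup>2) sums (L2_norm M (X k))\<^sup>2) \<and>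
     (\<forall>n\<ge>1. prob_space.indep_vars M (\<lambda>_. borel)
        (\<lambda>k \<omega>. Z n k \<omega> - Z n (k - 1) \<omega>) {1..})"
proof -
  note filt = assms(1) and X_mart = assms(6)
  have X_F: "X k \<in> borel_measurable (F k)" and X_sq: "square_integrable M (X k)" for k
    using X_mart by (auto simp: L2_martingale_def)
  define D where "D k = (\<lambda>\<omega>. X k \<omega> - X (k - 1) \<omega>)" for k
  have D_F: "D k \<in> borel_measurable (F k)" for k
    unfolding D_def
    by (intro borel_measurable_diff X_F measurable_from_subalg[OF filtered_subalgebra_mono[OF filt] X_F]) simp
  have D_sq: "square_integrable M (D k)" for k
    unfolding D_def by (intro square_integrable_diff X_sq)
  \<comment> \<open>The martingale identity in integrated form, as required for the expansion of one
    increment.\<close>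
  have D_0: "(\<integral>\<omega>. indicator A \<omega> * D k \<omega> $ i \<partial>M) = 0" if k: "k \<ge> 1" and A: "A \<in> sets (F (k - 1))" for k A i
  proof -
    interpret prob_subalgebra M "F (k - 1)" by (rule filtered_prob_subalgebra[OF filt])
    note int = square_integrable_integrable_nth[OF X_sq]
    have intA: "integrable M (\<lambda>x. indicator A x * X k x $ i)" for k
      using integrable_mult_indicator[OF sets_G[OF A] int] by simp
    have "AE \<omega> in M. real_cond_exp M (F (k - 1)) (\<lambda>\<omega>. X k \<omega> $ i) \<omega> = X (k - 1) \<omega> $ i"
      using X_mart k by (auto simp: L2_martingale_def)
    then have ae: "AE \<omega> in M. indicator A \<omega> * real_cond_exp M (F (k - 1)) (\<lambda>\<omega>. X k \<omega> $ i) \<omega>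
        = indicator A \<omega> * X (k - 1) \<omega> $ i"
      by eventually_elim simp
    have "(\<integral>\<omega>. indicator A \<omega> * X k \<omega> $ i \<partial>M)
        = (\<integral>\<omega>. indicator A \<omega> * real_cond_exp M (F (k - 1)) (\<lambda>\<omega>. X k \<omega> $ i) \<omega> \<partial>M)"
      using real_cond_exp_intA[OF int A, of k i] by (simp add: set_lebesgue_integral_def)
    also have "\<dots> = (\<integral>\<omega>. indicator A \<omega> * X (k - 1) \<omega> $ i \<partial>M)"
      using sets_G[OF A] intA by (intro integral_cong_AE ae) auto
    finally show ?thesis
      using intA by (simp add: D_def right_diff_distrib)
  qed
  define expansion where "expansion k Y \<longleftrightarrow>
    (\<forall>n. Y n \<in> borel_measurable (F k) \<and> square_integrable M (Y n) \<and> indep_of_algebra M (Y n) (F (k - 1)) \<and>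
       (\<forall>A\<in>sets (F (k - 1)). \<forall>i. (\<integral>x. indicator A x * Y n x $ i \<partial>M) = 0)) \<and>
    (\<lambda>N. L2_norm M (\<lambda>x. D k x - (\<Sum>n<N. Y n x))) \<longlonglongrightarrow> 0 \<and>
    (\<lambda>n. (L2_norm M (Y n))\<^sup>2) sums (L2_norm M (D k))\<^sup>2" for k and Y :: "nat \<Rightarrow> 'a \<Rightarrow> real ^ 'm"
  have "\<exists>Y. expansion k Y" if k: "k \<ge> 1" for k
  proof -
    interpret prob_subalgebra M "F (k - 1)" by (rule filtered_prob_subalgebra[OF filt])
    interpret prob_step M "F (k - 1)" "F k" "U k"
      using filt assms(3)[OF k] assms(4)[OF k] assms(5)[OF k]
      by unfold_locales (auto simp: filtered_prob_space_def intro: filtered_subalgebra_mono)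
    show ?thesis unfolding expansion_def by (rule one_step_decomposition[OF D_F D_sq D_0[OF k]])
  qed
  then obtain Y where "\<And>k. k \<ge> 1 \<Longrightarrow> expansion k (Y k)" by metis
  then have Y: "\<And>k n. k \<ge> 1 \<Longrightarrow> Y k n \<in> borel_measurable (F k)"
      "\<And>k n. k \<ge> 1 \<Longrightarrow> square_integrable M (Y k n)"
      "\<And>k n. k \<ge> 1 \<Longrightarrow> indep_of_algebra M (Y k n) (F (k - 1))"
      "\<And>k n A i. k \<ge> 1 \<Longrightarrow> A \<in> sets (F (k - 1)) \<Longrightarrow> (\<integral>x. indicator A x * Y k n x $ i \<partial>M) = 0"
    and Y_lim: "\<And>k. k \<ge> 1 \<Longrightarrow> (\<lambda>N. L2_norm M (\<lambda>x. D k x - (\<Sum>n<N. Y k n x))) \<longlonglongrightarrow> 0"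
    and Y_sums: "\<And>k. k \<ge> 1 \<Longrightarrow> (\<lambda>n. (L2_norm M (Y k n))\<^sup>2) sums (L2_norm M (D k))\<^sup>2"
    by (simp_all add: expansion_def)
  \<comment> \<open>The \<open>n\<close>-th martingale collects the \<open>n\<close>-th terms of the
    expansions of all increments; these are indexed from 0, the martingales from 1.\<close>
  define Z where "Z n k = (\<lambda>\<omega>. \<Sum>j\<in>{1..k}. Y j (n - 1) \<omega>)" for n k
  have Z_diff: "(\<lambda>\<omega>. Z n k \<omega> - Z n (k - 1) \<omega>) = Y k (n - 1)" if "k \<ge> 1" for n k
    using that by (cases k) (auto simp: Z_def)
  \<comment> \<open>The vanishing start of \<open>X\<close> enters here.\<close>
  have X_telescope: "X k \<omega> = (\<Sum>j\<in>{1..k}. D j \<omega>)" if "\<omega> \<in> space M" for k \<omega>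
    by (induction k) (use assms(7)[OF that] in \<open>auto simp: D_def\<close>)
  have Y_md: "martingale_differences M F (\<lambda>k. Y k n)" for n
    by unfold_locales (use filt Y in auto)
  have D_md: "martingale_differences M F D"
    by unfold_locales (use filt D_F D_sq D_0 in auto)
  \<comment> \<open>The one-step remainders are again martingale differences, so their sum over time
    has a norm computed by Pythagoras.\<close>
  have E_md: "martingale_differences M F (\<lambda>k \<omega>. D k \<omega> - (\<Sum>n<N. Y k n \<omega>))" for N
  proof (unfold_locales, rule filt)
    fix k :: nat assume k: "k \<ge> 1"
    show "(\<lambda>\<omega>. D k \<omega> - (\<Sum>n<N. Y k n \<omega>)) \<in> borel_measurable (F k)"
      by (intro borel_measurable_diff borel_measurable_sum D_F Y(1)[OF k])
    show "square_integrable M (\<lambda>\<omega>. D k \<omega> - (\<Sum>n<N. Y k n \<omega>))"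
      by (intro square_integrable_diff square_integrable_sum D_sq Y(2)[OF k])
    interpret prob_subalgebra M "F (k - 1)" by (rule filtered_prob_subalgebra[OF filt])
    fix A i assume A: "A \<in> sets (F (k - 1))"
    have intA: "integrable M (\<lambda>x. indicator A x * f x $ i)" if "square_integrable M f" for f :: "'a \<Rightarrow> real ^ 'm"
      using integrable_mult_indicator[OF sets_G[OF A] square_integrable_integrable_nth[OF that]] by simp
    have "(\<integral>\<omega>. indicator A \<omega> * (D k \<omega> - (\<Sum>n<N. Y k n \<omega>)) $ i \<partial>M) =
      (\<integral>\<omega>. indicator A \<omega> * D k \<omega> $ i - (\<Sum>n<N. indicator A \<omega> * Y k n \<omega> $ i) \<partial>M)"
      by (simp add: right_diff_distrib sum_distrib_left)
    also have "\<dots> = (\<integral>\<omega>. indicator A \<omega> * D k \<omega> $ i \<partial>M) - (\<Sum>n<N. \<integral>\<omega>. indicator A \<omega> * Y k n \<omega> $ i \<partial>M)"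
      using intA[OF D_sq] intA[OF Y(2)[OF k]]
      by (subst Bochner_Integration.integral_diff) (auto simp: Bochner_Integration.integral_sum simp del: sum_indicator_mult)
    finally show "(\<integral>\<omega>. indicator A \<omega> * (D k \<omega> - (\<Sum>n<N. Y k n \<omega>)) $ i \<partial>M) = 0"
      using D_0[OF k A] Y(4)[OF k A] by simp
  qed
  have X_norm: "(L2_norm M (X k))\<^sup>2 = (\<Sum>j\<in>{1..k}. (L2_norm M (D j))\<^sup>2)" for k
  proof -
    have "(L2_norm M (X k))\<^sup>2 = (L2_norm M (\<lambda>\<omega>. \<Sum>j\<in>{1..k}. D j \<omega>))\<^sup>2"
      unfolding L2_norm_power2 by (intro Bochner_Integration.integral_cong) (simp_all add: X_telescope)
    also note martingale_differences.partial_sum_energy[OF D_md]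
    finally show ?thesis .
  qed
  have Z_norm: "(L2_norm M (Z n k))\<^sup>2 = (\<Sum>j\<in>{1..k}. (L2_norm M (Y j (n - 1)))\<^sup>2)" for n k
    unfolding martingale_differences.partial_sum_energy[OF Y_md, symmetric] Z_def ..
  \<comment> \<open>After exchanging the sums over \<open>n\<close> and over time, the error at time
    \<open>k\<close> is controlled by \<open>k\<close> one-step errors, each of which tends to
    0.\<close>
  have rem_norm: "(L2_norm M (\<lambda>\<omega>. X k \<omega> - (\<Sum>n=1..N. Z n k \<omega>)))\<^sup>2 =
      (\<Sum>j\<in>{1..k}. (L2_norm M (\<lambda>\<omega>. D j \<omega> - (\<Sum>n<N. Y j n \<omega>)))\<^sup>2)" for N k
  proof -
    have "X k \<omega> - (\<Sum>n=1..N. Z n k \<omega>) = (\<Sum>j\<in>{1..k}. D j \<omega> - (\<Sum>n<N. Y j n \<omega>))"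
      if "\<omega> \<in> space M" for \<omega>
    proof -
      have "(\<Sum>n=1..N. Z n k \<omega>) = (\<Sum>n<N. Z (Suc n) k \<omega>)"
        by (simp add: sum.atLeast1_atMost_eq)
      also have "\<dots> = (\<Sum>j\<in>{1..k}. \<Sum>n<N. Y j n \<omega>)"
        unfolding Z_def by (subst sum.swap) simp
      finally show ?thesis by (simp add: X_telescope[OF that] sum_subtractf)
    qed
    then have "(L2_norm M (\<lambda>\<omega>. X k \<omega> - (\<Sum>n=1..N. Z n k \<omega>)))\<^sup>2 =
        (L2_norm M (\<lambda>\<omega>. \<Sum>j\<in>{1..k}. D j \<omega> - (\<Sum>n<N. Y j n \<omega>)))\<^sup>2"
      unfolding L2_norm_power2 by (intro Bochner_Integration.integral_cong) simp_all
    also note martingale_differences.partial_sum_energy[OF E_md]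
    finally show ?thesis .
  qed
  show ?thesis
  proof (intro exI[of _ Z] conjI allI impI ballI)
    fix n :: nat
    show "L2_martingale M F (Z n)"
      using martingale_differences.partial_sum_martingale[OF Y_md[of "n - 1"]] by (simp add: Z_def[abs_def])
    show "Z n 0 \<omega> = 0" for \<omega> by (simp add: Z_def)
    show "indep_of_algebra M (\<lambda>\<omega>. Z n k \<omega> - Z n (k - 1) \<omega>) (F (k - 1))" if "1 \<le> k" for k
      unfolding Z_diff[OF that] by (rule Y(3)[OF that])
    interpret prob_space M using filt by (simp add: filtered_prob_space_def)
    have "indep_vars (\<lambda>_. borel) (\<lambda>k. Y k (n - 1)) {1..}"
      by (rule indep_vars_adapted[OF filt Y(1) Y(3)])
    then show "indep_vars (\<lambda>_. borel) (\<lambda>k \<omega>. Z n k \<omega> - Z n (k - 1) \<omega>) {1..}"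
      by (rule indep_vars_cong[THEN iffD1, rotated -1]) (simp_all only: Z_diff atLeast_iff)
  next
    fix k :: nat
    show "L2_sums M (\<lambda>n. Z n k) (X k)"
      unfolding L2_sums_def
    proof (intro conjI allI impI X_sq)
      show "square_integrable M (Z n k)" for n
        using martingale_differences.partial_sum_sq[OF Y_md] by (simp add: Z_def)
      have "(\<lambda>N. (L2_norm M (\<lambda>\<omega>. X k \<omega> - (\<Sum>n=1..N. Z n k \<omega>)))\<^sup>2) \<longlonglongrightarrow> 0"
        unfolding rem_norm
        by (rule tendsto_null_sum) (use tendsto_power[OF Y_lim, of _ 2] in auto)
      from tendsto_real_sqrt[OF this]
      show "(\<lambda>N. L2_norm M (\<lambda>\<omega>. X k \<omega> - (\<Sum>n=1..N. Z n k \<omega>))) \<longlonglongrightarrow> 0"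
        by simp
    qed
    \<comment> \<open>Both sides split over the increments by Pythagoras, and the finitely many
      one-step identities are added.\<close>
    show "(\<lambda>n. (L2_norm M (Z (Suc n) k))\<^sup>2) sums (L2_norm M (X k))\<^sup>2"
      unfolding X_norm Z_norm diff_Suc_1 by (intro sums_sum Y_sums) simp
  qed
qed

end
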